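(* Let $S$ be any infinite set of positive integers, let $K_0=\mathbb{Q}(\{\zeta_n+\overline{\zeta_n}:n\in S\})$, and let $K_1$ be the maximal totally real subfield of $K_0^{(2)}$. If $K$ is any totally real extension of $K_1$ and $L$ is any totally imaginary quadratic extension of $K$, then the first-order theory of $\mathcal{O}_L$ (in the language of rings) is undecidable.
   Context: $\zeta_n$ denotes a primitive $n$-th root of unity in $\overline{\mathbb{Q}}\subseteq\mathbb{C}$ and $\overline{\zeta_n}$ its complex conjugate. $\mathcal{O}_F$ is the ring of algebraic integers of a field $F$. $F^{(2)}$ is the compositum in $\overline{\mathbb{Q}}$ of all extensions of $F$ of degree at most $2$. A field is totally real if all its elements have only real conjugates; totally imaginary means having no embedding into $\mathbb{R}$. *)

theory Defs
  imports "HOL-Algebra.Algebra" "HOL-Algebra.Algebraic_Closure_Type" "HOL-Library.Nat_Bijection"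
begin

section \<open>Subfields of the algebraic numbers\<close>

text \<open>Number fields of possibly infinite degree are subfields of the complex field that consist of
  algebraic numbers.\<close>

abbreviation CC :: "complex ring"
  where "CC \<equiv> ring_of_type_algebra"

abbreviation RR :: "real ring"
  where "RR \<equiv> ring_of_type_algebra"

definition algebraic_field :: "complex set \<Rightarrow> bool"
  where "algebraic_field F \<longleftrightarrow> subfield F CC \<and> (\<forall>x\<in>F. algebraic x)"

definition primitive_root_of_unity :: "nat \<Rightarrow> complex \<Rightarrow> bool"
  where "primitive_root_of_unity n z \<longleftrightarrow>
    0 < n \<and> z ^ n = 1 \<and> (\<forall>k. 0 < k \<and> k < n \<longrightarrow> z ^ k \<noteq> 1)"

text \<open>Algebraic numbers are conjugate (over the rationals) if they have the same minimal
  polynomial, i.e. are roots of the same irreducible rational polynomial.\<close>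

definition conjugate_over_Q :: "complex \<Rightarrow> complex \<Rightarrow> bool"
  where "conjugate_over_Q x y \<longleftrightarrow>
    (\<exists>p :: rat poly. comm_semiring_1_class.irreducible p \<and>
       poly (map_poly of_rat p) x = 0 \<and> poly (map_poly of_rat p) y = 0)"

definition totally_real :: "complex set \<Rightarrow> bool"
  where "totally_real F \<longleftrightarrow>
    algebraic_field F \<and> (\<forall>x\<in>F. \<forall>y. conjugate_over_Q x y \<longrightarrow> y \<in> \<real>)"

definition totally_imaginary :: "complex set \<Rightarrow> bool"
  where "totally_imaginary F \<longleftrightarrow>
    algebraic_field F \<and> ring_hom (CC\<lparr>carrier := F\<rparr>) RR = {}"

definition extension_of_degree :: "nat \<Rightarrow> complex set \<Rightarrow> complex set \<Rightarrow> bool"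
  where "extension_of_degree d F E \<longleftrightarrow>
    subfield F CC \<and> subfield E CC \<and> F \<subseteq> E \<and> ring.dimension CC d F E"

definition quadratic_compositum :: "complex set \<Rightarrow> complex set"
  where "quadratic_compositum F =
    generate_field CC (\<Union>{E. algebraic_field E \<and> (\<exists>d\<le>2. extension_of_degree d F E)})"

definition maximal_totally_real_subfield :: "complex set \<Rightarrow> complex set \<Rightarrow> bool"
  where "maximal_totally_real_subfield M F \<longleftrightarrow>
    M \<subseteq> F \<and> totally_real M \<and> (\<forall>E. E \<subseteq> F \<and> totally_real E \<and> M \<subseteq> E \<longrightarrow> E = M)"

definition ring_of_integers :: "complex set \<Rightarrow> complex ring"
  where "ring_of_integers F = CC\<lparr>carrier := {x \<in> F. algebraic_int x}\<rparr>"


section \<open>First-order logic in the language of rings\<close>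

datatype rterm = Var nat | Zero | One | Add rterm rterm | Neg rterm | Mul rterm rterm

datatype rform = FEq rterm rterm | FNot rform | FAnd rform rform | FEx nat rform

primrec term_val :: "('a, 'b) ring_scheme \<Rightarrow> (nat \<Rightarrow> 'a) \<Rightarrow> rterm \<Rightarrow> 'a" where
  "term_val R e (Var n) = e n"
| "term_val R e Zero = \<zero>\<^bsub>R\<^esub>"
| "term_val R e One = \<one>\<^bsub>R\<^esub>"
| "term_val R e (Add s t) = term_val R e s \<oplus>\<^bsub>R\<^esub> term_val R e t"
| "term_val R e (Neg t) = \<ominus>\<^bsub>R\<^esub> term_val R e t"
| "term_val R e (Mul s t) = term_val R e s \<otimes>\<^bsub>R\<^esub> term_val R e t"

primrec satisfies :: "('a, 'b) ring_scheme \<Rightarrow> (nat \<Rightarrow> 'a) \<Rightarrow> rform \<Rightarrow> bool" where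
  "satisfies R e (FEq s t) \<longleftrightarrow> term_val R e s = term_val R e t"
| "satisfies R e (FNot p) \<longleftrightarrow> \<not> satisfies R e p"
| "satisfies R e (FAnd p q) \<longleftrightarrow> satisfies R e p \<and> satisfies R e q"
| "satisfies R e (FEx n p) \<longleftrightarrow> (\<exists>a\<in>carrier R. satisfies R (e(n := a)) p)"

primrec term_vars :: "rterm \<Rightarrow> nat set" where
  "term_vars (Var n) = {n}"
| "term_vars Zero = {}"
| "term_vars One = {}"
| "term_vars (Add s t) = term_vars s \<union> term_vars t"
| "term_vars (Neg t) = term_vars t"
| "term_vars (Mul s t) = term_vars s \<union> term_vars t"

primrec free_vars :: "rform \<Rightarrow> nat set" where
  "free_vars (FEq s t) = term_vars s \<union> term_vars t"
| "free_vars (FNot p) = free_vars p"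
| "free_vars (FAnd p q) = free_vars p \<union> free_vars q"
| "free_vars (FEx n p) = free_vars p - {n}"

definition first_order_theory :: "('a, 'b) ring_scheme \<Rightarrow> rform set"
  where "first_order_theory R =
    {p. free_vars p = {} \<and> (\<forall>e \<in> UNIV \<rightarrow> carrier R. satisfies R e p)}"


section \<open>Decidability\<close>

text \<open>Codes of the partial recursive functions: zero, successor, projections, composition,
  primitive recursion and minimization. Arities are not tracked: a code of the wrong arity may
  denote a function that is undefined on some argument lists.\<close>

datatype recf =
  RZero | RSucc | RProj nat | RComp recf "recf list" | RPrim recf recf | RMin recf

inductive rec_eval :: "recf \<Rightarrow> nat list \<Rightarrow> nat \<Rightarrow> bool" where
  zero: "rec_eval RZero xs 0"
| succ: "rec_eval RSucc [x] (Suc x)"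
| proj: "i < length xs \<Longrightarrow> rec_eval (RProj i) xs (xs ! i)"
| comp: "length ys = length gs \<Longrightarrow> (\<forall>i<length gs. rec_eval (gs ! i) xs (ys ! i)) \<Longrightarrow>
    rec_eval f ys z \<Longrightarrow> rec_eval (RComp f gs) xs z"
| prim_0: "rec_eval f xs y \<Longrightarrow> rec_eval (RPrim f g) (0 # xs) y"
| prim_Suc: "rec_eval (RPrim f g) (n # xs) r \<Longrightarrow> rec_eval g (n # r # xs) y \<Longrightarrow>
    rec_eval (RPrim f g) (Suc n # xs) y"
| min: "rec_eval f (n # xs) 0 \<Longrightarrow> (\<forall>m<n. \<exists>y. rec_eval f (m # xs) (Suc y)) \<Longrightarrow>
    rec_eval (RMin f) xs n"

definition recursive_set :: "nat set \<Rightarrow> bool"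
  where "recursive_set A \<longleftrightarrow> (\<exists>f. \<forall>n. rec_eval f [n] (if n \<in> A then 1 else 0))"

inductive_cases rec_eval_elims:
  "rec_eval RZero xs z" "rec_eval RSucc xs z" "rec_eval (RProj i) xs z"
  "rec_eval (RComp f gs) xs z" "rec_eval (RPrim f g) (0 # xs) z"
  "rec_eval (RPrim f g) (Suc n # xs) z" "rec_eval (RMin f) xs z"

lemma rec_eval_unique: "rec_eval f xs y \<Longrightarrow> rec_eval f xs z \<Longrightarrow> z = y"
proof (induction arbitrary: z rule: rec_eval.induct)
  case (zero xs)
  then show ?case by (auto elim: rec_eval_elims(1))
next
  case (succ x)
  then show ?case by (auto elim: rec_eval_elims(2))
next
  case (proj i xs)
  then show ?case by (auto elim: rec_eval_elims(3))
next
  case (comp ys gs xs f y)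
  from comp.prems obtain zs where zs: "length zs = length gs"
    "\<forall>i<length gs. rec_eval (gs ! i) xs (zs ! i)" "rec_eval f zs z"
    by (rule rec_eval_elims(4))
  have "zs = ys"
    using zs(1,2) comp.hyps(1) comp.IH(1) by (intro nth_equalityI) auto
  with zs(3) comp.IH(2) show ?case by simp
next
  case (prim_0 f xs y g)
  from prim_0.prems show ?case by (rule rec_eval_elims(5)) (rule prim_0.IH)
next
  case (prim_Suc f g n xs r y)
  from prim_Suc.prems obtain s where "rec_eval (RPrim f g) (n # xs) s" "rec_eval g (n # s # xs) z"
    by (rule rec_eval_elims(6))
  with prim_Suc.IH show ?case by metis
next
  case (min f n xs)
  from min.prems have z: "rec_eval f (z # xs) 0" "\<forall>m<z. \<exists>y. rec_eval f (m # xs) (Suc y)"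
    by (auto elim: rec_eval_elims(7))
  have "\<not> z < n" using z(1) min.IH(2) by fastforce
  moreover have "\<not> n < z" using z(2) min.IH(1) by fastforce
  ultimately show ?case by (simp add: not_less)
qed

text \<open>Goedel numbering.\<close>

primrec term_code :: "rterm \<Rightarrow> nat" where
  "term_code (Var n) = prod_encode (0, n)"
| "term_code Zero = prod_encode (1, 0)"
| "term_code One = prod_encode (2, 0)"
| "term_code (Add s t) = prod_encode (3, prod_encode (term_code s, term_code t))"
| "term_code (Neg t) = prod_encode (4, term_code t)"
| "term_code (Mul s t) = prod_encode (5, prod_encode (term_code s, term_code t))"

primrec form_code :: "rform \<Rightarrow> nat" where
  "form_code (FEq s t) = prod_encode (0, prod_encode (term_code s, term_code t))"
| "form_code (FNot p) = prod_encode (1, form_code p)"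
| "form_code (FAnd p q) = prod_encode (2, prod_encode (form_code p, form_code q))"
| "form_code (FEx n p) = prod_encode (3, prod_encode (n, form_code p))"

lemma term_code_eqD: "term_code s = term_code t \<Longrightarrow> s = t"
proof (induction s arbitrary: t)
  case (Var n) then show ?case by (cases t) auto
next
  case Zero then show ?case by (cases t) auto
next
  case One then show ?case by (cases t) auto
next
  case (Add s1 s2) then show ?case by (cases t) auto
next
  case (Neg s) then show ?case by (cases t) auto
next
  case (Mul s1 s2) then show ?case by (cases t) auto
qed

lemma form_code_eqD: "form_code p = form_code q \<Longrightarrow> p = q"
proof (induction p arbitrary: q)
  case (FEq s t) then show ?case by (cases q) (auto dest: term_code_eqD)
next
  case (FNot p) then show ?case by (cases q) auto
next
  case (FAnd p1 p2) then show ?case by (cases q) auto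
next
  case (FEx n p) then show ?case by (cases q) auto
qed

lemma inj_form_code: "inj form_code"
  by (rule injI) (rule form_code_eqD)

definition decidable_theory :: "rform set \<Rightarrow> bool"
  where "decidable_theory T \<longleftrightarrow> recursive_set (form_code ` T)"

end

theory Submission
  imports Defs "HOL-Number_Theory.Cong" "Jordan_Normal_Form.Char_Poly"
begin

text \<open>A unit \<open>u\<close> of the ring of integers of \<open>L\<close> with \<open>u \<equiv> 1\<close> modulo \<open>3\<close> is real: all conjugates of
  \<open>(u / cnj u - 1) / 3\<close> have absolute value at most \<open>2 / 3\<close>, so this algebraic integer vanishes. Hence
  \<open>u + 1 / u\<close> is totally real with all conjugates of absolute value at least \<open>2\<close>, and every
  \<open>9 * z + 2\<close> with \<open>z\<close> natural has this form, because the square roots of natural numbers lie in the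
  maximal totally real subfield. A relation \<open>(1 + 9 * w) * (u + 1 / u) = s\<close> with \<open>s\<close> of the same
  form therefore bounds all conjugates of \<open>w\<close>.

  This makes the set of natural numbers definable: \<open>v\<close> is natural iff it lies in one of the sets of such
  bounded \<open>w\<close> with \<open>1 + d * (w + c)\<close> dividing \<open>f\<close> that contain \<open>w - 1\<close> together with every
  \<open>w \<noteq> 0\<close>. Boundedness forces the descent from \<open>v\<close> to end in \<open>0\<close>. Conversely, take \<open>f\<close> to be the
  product of the \<open>1 + d * (k + c)\<close> over \<open>k \<le> n\<close>: any further \<open>1 + d * (w + c)\<close> dividing \<open>f\<close> also
  divides the product of the \<open>k - w\<close>, all conjugates of which are smaller if \<open>d\<close> is large, so that
  \<open>w\<close> is one of the \<open>k\<close>. Undecidability follows by diagonalization, since all recursive functions are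
  arithmetical.\<close>

section \<open>Definable relations\<close>

lemma finite_term_vars: "finite (term_vars t)"
  by (induction t) auto

lemma finite_free_vars: "finite (free_vars p)"
  by (induction p) (auto simp: finite_term_vars)

lemma term_val_cong: "(\<And>i. i \<in> term_vars t \<Longrightarrow> e i = e' i) \<Longrightarrow> term_val R e t = term_val R e' t"
  by (induction t) auto

lemma satisfies_cong:
  "(\<And>i. i \<in> free_vars p \<Longrightarrow> e i = e' i) \<Longrightarrow> satisfies R e p \<longleftrightarrow> satisfies R e' p"
proof (induction p arbitrary: e e')
  case (FEq s t)
  then show ?case using term_val_cong[of s e e' R] term_val_cong[of t e e' R] by auto
next
  case (FEx n p)
  have "satisfies R (e(n := a)) p \<longleftrightarrow> satisfies R (e'(n := a)) p" for a
    by (rule FEx.IH) (use FEx.prems in auto)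
  then show ?case by simp
next
  case (FAnd p q)
  have "satisfies R e p \<longleftrightarrow> satisfies R e' p" "satisfies R e q \<longleftrightarrow> satisfies R e' q"
    using FAnd.prems by (intro FAnd.IH; auto)+
  then show ?case by simp
next
  case (FNot p)
  have "satisfies R e p \<longleftrightarrow> satisfies R e' p"
    by (rule FNot.IH) (use FNot.prems in auto)
  then show ?case by simp
qed

text \<open>The values that variables may take are the elements of \<open>V\<close>, and \<open>enc\<close> is an embedding of
  \<open>V\<close> into the ring with carrier \<open>A\<close> whose image is first-order definable. This is used both for
  \<open>V = A\<close> and for the natural numbers in \<open>A\<close>.\<close>

locale definability =
  fixes A :: "'a::comm_ring_1 set" and V :: "'b::comm_semiring_1 set" and enc :: "'b \<Rightarrow> 'a"
  assumes zero_V: "0 \<in> V" and one_V: "1 \<in> V"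
    and add_V: "x \<in> V \<Longrightarrow> y \<in> V \<Longrightarrow> x + y \<in> V"
    and mult_V: "x \<in> V \<Longrightarrow> y \<in> V \<Longrightarrow> x * y \<in> V"
    and enc_zero: "enc 0 = 0" and enc_one: "enc 1 = 1"
    and enc_add: "x \<in> V \<Longrightarrow> y \<in> V \<Longrightarrow> enc (x + y) = enc x + enc y"
    and enc_mult: "x \<in> V \<Longrightarrow> y \<in> V \<Longrightarrow> enc (x * y) = enc x * enc y"
    and inj_enc: "inj_on enc V"
    and enc_A: "x \<in> V \<Longrightarrow> enc x \<in> A"
    and definable_range: "\<exists>p. \<forall>e\<in>UNIV \<rightarrow> A.
      satisfies (ring_of_type_algebra\<lparr>carrier := A\<rparr>) e p \<longleftrightarrow> e j \<in> enc ` V"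
begin

abbreviation R :: "'a ring"
  where "R \<equiv> ring_of_type_algebra\<lparr>carrier := A\<rparr>"

lemma R_simps:
  "carrier R = A" "\<zero>\<^bsub>ring_of_type_algebra\<^esub> = (0 :: 'a)" "\<one>\<^bsub>ring_of_type_algebra\<^esub> = (1 :: 'a)"
  "x \<oplus>\<^bsub>ring_of_type_algebra\<^esub> y = x + (y :: 'a)" "x \<otimes>\<^bsub>ring_of_type_algebra\<^esub> y = x * (y :: 'a)"
  by (simp_all add: ring_of_type_algebra_def)

definition Rel :: "nat \<Rightarrow> ('b list \<Rightarrow> bool) \<Rightarrow> bool"
  where "Rel k P \<longleftrightarrow> (\<forall>vs. length vs = k \<longrightarrow>
    (\<exists>p. \<forall>r\<in>UNIV \<rightarrow> V. satisfies R (enc \<circ> r) p \<longleftrightarrow> P (map r vs)))"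

text \<open>Only functions given by ring terms are meant. A function with a merely definable graph
  enters as a relation.\<close>

definition Fn :: "nat \<Rightarrow> ('b list \<Rightarrow> 'b) \<Rightarrow> bool"
  where "Fn k t \<longleftrightarrow> (\<forall>vs. length vs = k \<longrightarrow>
    (\<exists>s. \<forall>r\<in>UNIV \<rightarrow> V. t (map r vs) \<in> V \<and> term_val R (enc \<circ> r) s = enc (t (map r vs))))"

lemma RelI:
  assumes "\<And>vs. length vs = k \<Longrightarrow> \<exists>p. \<forall>r\<in>UNIV \<rightarrow> V. satisfies R (enc \<circ> r) p \<longleftrightarrow> P (map r vs)"
  shows "Rel k P"
  using assms by (auto simp: Rel_def)

lemma RelE:
  assumes "Rel k P" "length vs = k"
  obtains p where "\<And>r. r \<in> UNIV \<rightarrow> V \<Longrightarrow> satisfies R (enc \<circ> r) p \<longleftrightarrow> P (map r vs)"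
  using assms by (force simp: Rel_def)

lemma FnE:
  assumes "Fn k t" "length vs = k"
  obtains s where "\<And>r. r \<in> UNIV \<rightarrow> V \<Longrightarrow> t (map r vs) \<in> V"
    "\<And>r. r \<in> UNIV \<rightarrow> V \<Longrightarrow> term_val R (enc \<circ> r) s = enc (t (map r vs))"
  using assms by (force simp: Fn_def)

lemma Fn_hd: "Fn (Suc k) hd"
  unfolding Fn_def
proof (intro allI impI)
  fix vs :: "nat list" assume "length vs = Suc k"
  then obtain v ws where "vs = v # ws" by (cases vs) auto
  then show "\<exists>s. \<forall>r\<in>UNIV \<rightarrow> V. hd (map r vs) \<in> V \<and> term_val R (enc \<circ> r) s = enc (hd (map r vs))"
    by (intro exI[of _ "Var v"]) auto
qed

lemma Fn_tl:
  assumes "Fn k t"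
  shows "Fn (Suc k) (\<lambda>xs. t (tl xs))"
  unfolding Fn_def
proof (intro allI impI)
  fix vs :: "nat list" assume "length vs = Suc k"
  then obtain v ws where vs: "vs = v # ws" "length ws = k" by (cases vs) auto
  from assms vs(2) obtain s where "\<And>r. r \<in> UNIV \<rightarrow> V \<Longrightarrow> t (map r ws) \<in> V"
    "\<And>r. r \<in> UNIV \<rightarrow> V \<Longrightarrow> term_val R (enc \<circ> r) s = enc (t (map r ws))" by (rule FnE) blast
  then show "\<exists>s. \<forall>r\<in>UNIV \<rightarrow> V. t (tl (map r vs)) \<in> V \<and>
      term_val R (enc \<circ> r) s = enc (t (tl (map r vs)))"
    using vs(1) by (intro exI[of _ s]) auto
qed

lemma Fn_0: "Fn k (\<lambda>_. 0)"
  unfolding Fn_def by (auto intro!: exI[of _ Zero] simp: R_simps zero_V enc_zero)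

lemma Fn_1: "Fn k (\<lambda>_. 1)"
  unfolding Fn_def by (auto intro!: exI[of _ One] simp: R_simps one_V enc_one)

lemma Fn_add:
  assumes "Fn k t" "Fn k u"
  shows "Fn k (\<lambda>xs. t xs + u xs)"
  unfolding Fn_def
proof (intro allI impI)
  fix vs :: "nat list" assume vs: "length vs = k"
  obtain s1 where s1: "\<And>r. r \<in> UNIV \<rightarrow> V \<Longrightarrow> t (map r vs) \<in> V"
    "\<And>r. r \<in> UNIV \<rightarrow> V \<Longrightarrow> term_val R (enc \<circ> r) s1 = enc (t (map r vs))"
    using FnE[OF assms(1) vs] by blast
  obtain s2 where s2: "\<And>r. r \<in> UNIV \<rightarrow> V \<Longrightarrow> u (map r vs) \<in> V"
    "\<And>r. r \<in> UNIV \<rightarrow> V \<Longrightarrow> term_val R (enc \<circ> r) s2 = enc (u (map r vs))"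
    using FnE[OF assms(2) vs] by blast
  show "\<exists>s. \<forall>r\<in>UNIV \<rightarrow> V. t (map r vs) + u (map r vs) \<in> V \<and>
      term_val R (enc \<circ> r) s = enc (t (map r vs) + u (map r vs))"
    by (intro exI[of _ "Add s1 s2"]) (simp add: s1 s2 add_V enc_add R_simps)
qed

lemma Fn_mult:
  assumes "Fn k t" "Fn k u"
  shows "Fn k (\<lambda>xs. t xs * u xs)"
  unfolding Fn_def
proof (intro allI impI)
  fix vs :: "nat list" assume vs: "length vs = k"
  obtain s1 where s1: "\<And>r. r \<in> UNIV \<rightarrow> V \<Longrightarrow> t (map r vs) \<in> V"
    "\<And>r. r \<in> UNIV \<rightarrow> V \<Longrightarrow> term_val R (enc \<circ> r) s1 = enc (t (map r vs))"
    using FnE[OF assms(1) vs] by blast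
  obtain s2 where s2: "\<And>r. r \<in> UNIV \<rightarrow> V \<Longrightarrow> u (map r vs) \<in> V"
    "\<And>r. r \<in> UNIV \<rightarrow> V \<Longrightarrow> term_val R (enc \<circ> r) s2 = enc (u (map r vs))"
    using FnE[OF assms(2) vs] by blast
  show "\<exists>s. \<forall>r\<in>UNIV \<rightarrow> V. t (map r vs) * u (map r vs) \<in> V \<and>
      term_val R (enc \<circ> r) s = enc (t (map r vs) * u (map r vs))"
    by (intro exI[of _ "Mul s1 s2"]) (simp add: s1 s2 mult_V enc_mult R_simps)
qed

lemma Fn_of_nat: "Fn k (\<lambda>_. of_nat n)"
proof (induction n)
  case (Suc n)
  then show ?case using Fn_add[OF Fn_1 Suc] by simp
qed (simp add: Fn_0)

lemma Fn_numeral: "Fn k (\<lambda>_. numeral n)"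
  using Fn_of_nat[of k "numeral n"] by simp

lemmas Fn_intros = Fn_hd Fn_tl Fn_0 Fn_1 Fn_add Fn_mult Fn_numeral

lemma Rel_eq:
  assumes "Fn k t" "Fn k u"
  shows "Rel k (\<lambda>xs. t xs = u xs)"
proof (rule RelI)
  fix vs :: "nat list" assume vs: "length vs = k"
  obtain s1 where s1: "\<And>r. r \<in> UNIV \<rightarrow> V \<Longrightarrow> t (map r vs) \<in> V"
    "\<And>r. r \<in> UNIV \<rightarrow> V \<Longrightarrow> term_val R (enc \<circ> r) s1 = enc (t (map r vs))"
    using FnE[OF assms(1) vs] by blast
  obtain s2 where s2: "\<And>r. r \<in> UNIV \<rightarrow> V \<Longrightarrow> u (map r vs) \<in> V"
    "\<And>r. r \<in> UNIV \<rightarrow> V \<Longrightarrow> term_val R (enc \<circ> r) s2 = enc (u (map r vs))"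
    using FnE[OF assms(2) vs] by blast
  show "\<exists>p. \<forall>r\<in>UNIV \<rightarrow> V. satisfies R (enc \<circ> r) p \<longleftrightarrow> t (map r vs) = u (map r vs)"
    by (intro exI[of _ "FEq s1 s2"]) (simp add: s1 s2 inj_on_eq_iff[OF inj_enc])
qed

lemma Rel_not:
  assumes "Rel k P"
  shows "Rel k (\<lambda>xs. \<not> P xs)"
proof (rule RelI)
  fix vs :: "nat list" assume "length vs = k"
  with assms obtain p where "\<And>r. r \<in> UNIV \<rightarrow> V \<Longrightarrow> satisfies R (enc \<circ> r) p \<longleftrightarrow> P (map r vs)"
    by (rule RelE) blast
  then show "\<exists>p. \<forall>r\<in>UNIV \<rightarrow> V. satisfies R (enc \<circ> r) p \<longleftrightarrow> \<not> P (map r vs)"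
    by (intro exI[of _ "FNot p"]) simp
qed

lemma Rel_conj:
  assumes "Rel k P" "Rel k Q"
  shows "Rel k (\<lambda>xs. P xs \<and> Q xs)"
proof (rule RelI)
  fix vs :: "nat list" assume vs: "length vs = k"
  obtain p where "\<And>r. r \<in> UNIV \<rightarrow> V \<Longrightarrow> satisfies R (enc \<circ> r) p \<longleftrightarrow> P (map r vs)"
    using RelE[OF assms(1) vs] by blast
  moreover obtain q where "\<And>r. r \<in> UNIV \<rightarrow> V \<Longrightarrow> satisfies R (enc \<circ> r) q \<longleftrightarrow> Q (map r vs)"
    using RelE[OF assms(2) vs] by blast
  ultimately show "\<exists>p. \<forall>r\<in>UNIV \<rightarrow> V. satisfies R (enc \<circ> r) p \<longleftrightarrow> P (map r vs) \<and> Q (map r vs)"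
    by (intro exI[of _ "FAnd p q"]) simp
qed

lemma Rel_disj:
  assumes "Rel k P" "Rel k Q"
  shows "Rel k (\<lambda>xs. P xs \<or> Q xs)"
  using Rel_not[OF Rel_conj[OF Rel_not[OF assms(1)] Rel_not[OF assms(2)]]] by simp

lemma Rel_imp:
  assumes "Rel k P" "Rel k Q"
  shows "Rel k (\<lambda>xs. P xs \<longrightarrow> Q xs)"
  unfolding imp_conv_disj by (intro Rel_disj Rel_not assms)

text \<open>The quantifier of the language ranges over \<open>A\<close>, so it is relativized to the
  definable image of \<open>V\<close> under \<open>enc\<close>.\<close>

lemma Rel_bex:
  assumes "Rel (Suc k) (\<lambda>xs. P (tl xs) (hd xs))"
  shows "Rel k (\<lambda>xs. \<exists>x\<in>V. P xs x)"
proof (rule RelI)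
  fix vs :: "nat list" assume vs: "length vs = k"
  \<comment> \<open>The formulas \<open>p\<close> and \<open>q\<close> below may have further free
    variables, but their truth values depend only on the values at \<open>j # vs\<close> and at
    \<open>j\<close>, so freshness for \<open>vs\<close> suffices.\<close>
  obtain j where j: "j \<notin> set vs"
    using ex_new_if_finite[OF infinite_UNIV_nat] by blast
  from vs have "length (j # vs) = Suc k" by simp
  from RelE[OF assms this]
  obtain p where p: "\<And>r. r \<in> UNIV \<rightarrow> V \<Longrightarrow> satisfies R (enc \<circ> r) p \<longleftrightarrow> P (map r vs) (r j)"
    by auto
  obtain q where q: "\<And>e. e \<in> UNIV \<rightarrow> A \<Longrightarrow> satisfies R e q \<longleftrightarrow> e j \<in> enc ` V"
    using definable_range[of j] by auto
  show "\<exists>p. \<forall>r\<in>UNIV \<rightarrow> V. satisfies R (enc \<circ> r) p \<longleftrightarrow> (\<exists>x\<in>V. P (map r vs) x)"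
  proof (intro exI[of _ "FEx j (FAnd q p)"] ballI)
    fix r :: "nat \<Rightarrow> 'b" assume r: "r \<in> UNIV \<rightarrow> V"
    have *: "satisfies R ((enc \<circ> r)(j := enc x)) p \<longleftrightarrow> P (map r vs) x" if "x \<in> V" for x
    proof -
      have "(enc \<circ> r)(j := enc x) = enc \<circ> r(j := x)" by auto
      moreover have "r(j := x) \<in> UNIV \<rightarrow> V" using r that by auto
      moreover have "map (r(j := x)) vs = map r vs" using j by auto
      ultimately show ?thesis using p[of "r(j := x)"] by (simp only: fun_upd_same)
    qed
    have **: "satisfies R ((enc \<circ> r)(j := a)) q \<longleftrightarrow> a \<in> enc ` V" if "a \<in> A" for a
    proof -
      have "(enc \<circ> r)(j := a) \<in> UNIV \<rightarrow> A" using r that enc_A by (auto simp: Pi_iff)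
      from q[OF this] show ?thesis by simp
    qed
    have "satisfies R (enc \<circ> r) (FEx j (FAnd q p)) \<longleftrightarrow>
        (\<exists>a\<in>A. a \<in> enc ` V \<and> satisfies R ((enc \<circ> r)(j := a)) p)"
      using ** by (simp add: R_simps)
    also have "\<dots> \<longleftrightarrow> (\<exists>x\<in>V. P (map r vs) x)"
      using enc_A by (auto simp: *)
    finally show "satisfies R (enc \<circ> r) (FEx j (FAnd q p)) \<longleftrightarrow> (\<exists>x\<in>V. P (map r vs) x)" .
  qed
qed

lemma Rel_ball:
  assumes "Rel (Suc k) (\<lambda>xs. P (tl xs) (hd xs))"
  shows "Rel k (\<lambda>xs. \<forall>x\<in>V. P xs x)"
  using Rel_not[OF Rel_bex[OF Rel_not[OF assms]]] by simp

text \<open>Here \<open>h\<close> rearranges variables and \<open>h'\<close> does the same with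
  values. This serves to use a relation below additional quantifiers.\<close>

lemma Rel_rename:
  fixes h :: "nat list \<Rightarrow> nat list"
  assumes "Rel m P" and "\<And>vs. length vs = k \<Longrightarrow> length (h vs) = m"
    and "\<And>r vs. length vs = k \<Longrightarrow> map r (h vs) = h' (map r vs)"
  shows "Rel k (\<lambda>xs. P (h' xs))"
proof (rule RelI)
  fix vs :: "nat list" assume vs: "length vs = k"
  show "\<exists>p. \<forall>r\<in>UNIV \<rightarrow> V. satisfies R (enc \<circ> r) p \<longleftrightarrow> P (h' (map r vs))"
    using RelE[OF assms(1) assms(2)[OF vs]] assms(3)[OF vs] by metis
qed

lemmas Rel_intros = Rel_eq Rel_not Rel_conj Rel_disj Rel_imp Rel_bex Rel_ball

end

section \<open>Arithmetical relations and undecidability\<close>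

primrec numeral_term :: "nat \<Rightarrow> rterm" where
  "numeral_term 0 = Zero"
| "numeral_term (Suc n) = Add (numeral_term n) One"

text \<open>Goedel's coding of a finite sequence by two numbers: the moduli are pairwise coprime, so
  the Chinese remainder theorem provides \<open>c\<close>.\<close>

lemma beta_function:
  fixes s :: "nat \<Rightarrow> nat"
  obtains c d :: nat where "\<forall>i\<le>n. c mod Suc (Suc i * d) = s i"
proof -
  define m where "m = Max (insert n (s ` {..n}))"
  have m: "n \<le> m" "\<And>i. i \<le> n \<Longrightarrow> s i \<le> m"
    unfolding m_def by (intro Max_ge; simp)+
  \<comment> \<open>Since \<open>m\<close> bounds both \<open>n\<close> and all \<open>s i\<close>,
    this \<open>d\<close> is divisible by every difference of distinct indices and exceeds every
    value.\<close>
  define d :: nat where "d = fact (Suc m)"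
  have "m < d" unfolding d_def by (meson Suc_le_eq fact_ge_self)
  have cop: "coprime (Suc (Suc i * d)) (Suc (Suc j * d))" if "i \<le> n" "j \<le> n" "i < j" for i j
  proof (rule coprimeI)
    fix c assume c: "c dvd Suc (Suc i * d)" "c dvd Suc (Suc j * d)"
    \<comment> \<open>Eliminating \<open>d\<close> from the two moduli leaves \<open>j - i\<close>.
      So \<open>c\<close> divides \<open>j - i\<close>, hence \<open>d\<close>, hence 1.\<close>
    have "c dvd Suc i * Suc (Suc j * d)" "c dvd Suc j * Suc (Suc i * d)"
      using c by (simp_all only: dvd_mult)
    moreover have "Suc j * Suc (Suc i * d) - Suc i * Suc (Suc j * d) = j - i"
      using that by (simp add: algebra_simps)
    ultimately have "c dvd j - i" by (metis dvd_diff_nat)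
    moreover have "j - i dvd d"
      unfolding d_def using that m(1) by (intro dvd_fact) auto
    ultimately have "c dvd d" by (rule dvd_trans)
    then have "c dvd Suc i * d" by simp
    with c(1) show "is_unit c"
      by (metis Suc_eq_plus1 dvd_add_right_iff)
  qed
  have "\<exists>x. \<forall>i\<in>{..n}. [x = s i] (mod Suc (Suc i * d))"
  proof (rule chinese_remainder_nat)
    show "\<forall>i\<in>{..n}. \<forall>j\<in>{..n}. i \<noteq> j \<longrightarrow> coprime (Suc (Suc i * d)) (Suc (Suc j * d))"
      using cop by (metis atMost_iff coprime_commute linorder_neqE_nat)
  qed simp
  then obtain c where c: "\<And>i. i \<le> n \<Longrightarrow> [c = s i] (mod Suc (Suc i * d))" by auto
  have "c mod Suc (Suc i * d) = s i" if "i \<le> n" for i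
  proof -
    have "s i < Suc (Suc i * d)" using m(2)[OF that] \<open>m < d\<close> by simp
    with c[OF that] show ?thesis by (simp add: cong_def)
  qed
  with that show ?thesis by blast
qed

section \<open>Evaluation of recursive functions as equivalences\<close>

lemma rec_eval_RZero: "rec_eval RZero xs z \<longleftrightarrow> z = 0"
  by (auto elim: rec_eval_elims(1) intro: rec_eval.zero)

lemma rec_eval_RSucc: "rec_eval RSucc xs z \<longleftrightarrow> (\<exists>x. xs = [x] \<and> z = Suc x)"
  by (auto elim: rec_eval_elims(2) intro: rec_eval.succ)

lemma rec_eval_RProj: "rec_eval (RProj i) xs z \<longleftrightarrow> i < length xs \<and> z = xs ! i"
  by (auto elim: rec_eval_elims(3) intro: rec_eval.proj)

lemma rec_eval_RComp:
  "rec_eval (RComp f gs) xs z \<longleftrightarrow> (\<exists>ys. list_all2 (\<lambda>g. rec_eval g xs) gs ys \<and> rec_eval f ys z)"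
proof
  assume "rec_eval (RComp f gs) xs z"
  then show "\<exists>ys. list_all2 (\<lambda>g. rec_eval g xs) gs ys \<and> rec_eval f ys z"
    by (rule rec_eval_elims(4)) (metis (no_types, lifting) list_all2_conv_all_nth)
next
  assume "\<exists>ys. list_all2 (\<lambda>g. rec_eval g xs) gs ys \<and> rec_eval f ys z"
  then obtain ys where "list_all2 (\<lambda>g. rec_eval g xs) gs ys" "rec_eval f ys z" by blast
  then show "rec_eval (RComp f gs) xs z"
    by (intro rec_eval.comp[of ys]) (auto simp: list_all2_conv_all_nth)
qed

lemma rec_eval_RMin:
  "rec_eval (RMin f) xs z \<longleftrightarrow>
    rec_eval f (z # xs) 0 \<and> (\<forall>m. m < z \<longrightarrow> (\<exists>y. rec_eval f (m # xs) (y + 1)))"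
  by (auto elim!: rec_eval_elims(7) intro: rec_eval.min)

text \<open>Primitive recursion is traded for the existence of the sequence of intermediate values,
  a form to which the beta function applies.\<close>

lemma rec_eval_RPrim:
  "rec_eval (RPrim f g) (n # xs) z \<longleftrightarrow>
    (\<exists>s. rec_eval f xs (s 0) \<and> (\<forall>i<n. rec_eval g (i # s i # xs) (s (Suc i))) \<and> s n = z)"
proof (induction n arbitrary: z)
  case 0
  show ?case
  proof
    assume "rec_eval (RPrim f g) (0 # xs) z"
    then have "rec_eval f xs z" by (rule rec_eval_elims(5))
    then show "\<exists>s. rec_eval f xs (s 0) \<and> (\<forall>i<0. rec_eval g (i # s i # xs) (s (Suc i))) \<and> s 0 = z"
      by (intro exI[of _ "\<lambda>_. z"]) simp
  qed (auto intro: rec_eval.prim_0)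
next
  case (Suc n)
  show ?case
  proof
    assume "rec_eval (RPrim f g) (Suc n # xs) z"
    then obtain r where r: "rec_eval (RPrim f g) (n # xs) r" "rec_eval g (n # r # xs) z"
      by (rule rec_eval_elims(6))
    from r(1) Suc.IH obtain s where s: "rec_eval f xs (s 0)"
      "\<forall>i<n. rec_eval g (i # s i # xs) (s (Suc i))" "s n = r" by blast
    show "\<exists>s. rec_eval f xs (s 0) \<and> (\<forall>i<Suc n. rec_eval g (i # s i # xs) (s (Suc i))) \<and> s (Suc n) = z"
      using s r(2) by (intro exI[of _ "s(Suc n := z)"]) (auto simp: less_Suc_eq)
  next
    assume "\<exists>s. rec_eval f xs (s 0) \<and> (\<forall>i<Suc n. rec_eval g (i # s i # xs) (s (Suc i))) \<and> s (Suc n) = z"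
    then obtain s where s: "rec_eval f xs (s 0)"
      "\<forall>i<Suc n. rec_eval g (i # s i # xs) (s (Suc i))" "s (Suc n) = z" by blast
    then have "rec_eval (RPrim f g) (n # xs) (s n)" using Suc.IH by auto
    with s(2,3) show "rec_eval (RPrim f g) (Suc n # xs) z" by (auto intro: rec_eval.prim_Suc)
  qed
qed

section \<open>Arithmetical relations, up to the graphs of all recursive functions\<close>

locale nat_definability = definability A "UNIV :: nat set" enc
  for A :: "'a::comm_ring_1 set" and enc :: "nat \<Rightarrow> 'a"
begin

lemma Rel_ex: "Rel (Suc k) (\<lambda>xs. P (tl xs) (hd xs)) \<Longrightarrow> Rel k (\<lambda>xs. \<exists>x. P xs x)"
  using Rel_bex[of k P] by simp

lemma Rel_all: "Rel (Suc k) (\<lambda>xs. P (tl xs) (hd xs)) \<Longrightarrow> Rel k (\<lambda>xs. \<forall>x. P xs x)"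
  using Rel_ball[of k P] by simp

lemma Fn_Suc: "Fn k t \<Longrightarrow> Fn k (\<lambda>xs. Suc (t xs))"
  using Fn_add[OF _ Fn_1] by simp

lemmas nat_intros = Fn_intros Fn_Suc Rel_eq Rel_not Rel_conj Rel_disj Rel_imp Rel_ex Rel_all

lemma Rel_less:
  assumes "Fn k t" "Fn k u"
  shows "Rel k (\<lambda>xs. t xs < u xs)"
proof -
  have "Rel k (\<lambda>xs. \<exists>x. t xs + x + 1 = u xs)"
    by (intro nat_intros assms)
  moreover have "(\<exists>x. a + x + 1 = b) \<longleftrightarrow> a < b" for a b :: nat
    by (auto simp: less_iff_Suc_add)
  ultimately show ?thesis by simp
qed

lemma Rel_mod:
  assumes "Fn k t" "Fn k u" "Fn k v"
  shows "Rel k (\<lambda>xs. t xs mod Suc (u xs) = v xs)"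
proof -
  have "Rel k (\<lambda>xs. v xs < Suc (u xs) \<and> (\<exists>x. t xs = Suc (u xs) * x + v xs))"
    by (intro nat_intros Rel_less assms)
  moreover have "b < Suc m \<and> (\<exists>x. a = Suc m * x + b) \<longleftrightarrow> a mod Suc m = b" for a b m :: nat
  proof
    assume "b < Suc m \<and> (\<exists>x. a = Suc m * x + b)"
    then show "a mod Suc m = b" by (auto simp del: mult_Suc)
  next
    assume "a mod Suc m = b"
    then show "b < Suc m \<and> (\<exists>x. a = Suc m * x + b)"
      by (metis mod_less_divisor mult_div_mod_eq zero_less_Suc)
  qed
  ultimately show ?thesis by simp
qed

text \<open>The quantifier over sequences \<open>s\<close> becomes one over two numbers
  \<open>c\<close> and \<open>d\<close> that code the values up to index
  \<open>n xs\<close>.\<close>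

lemma Rel_iterate:
  assumes n: "Fn k n" and z: "Fn k z"
    and P: "Rel (Suc k) (\<lambda>xs. P (tl xs) (hd xs))"
    and Q: "Rel (Suc (Suc (Suc k))) (\<lambda>xs. Q (tl (tl (tl xs))) (hd (tl (tl xs))) (hd (tl xs)) (hd xs))"
  shows "Rel k (\<lambda>xs. \<exists>s. P xs (s 0) \<and> (\<forall>i<n xs. Q xs i (s i) (s (Suc i))) \<and> s (n xs) = z xs)"
proof -
  \<comment> \<open>The variables \<open>c\<close> and \<open>d\<close> are bound outside those of
    \<open>P\<close> and \<open>Q\<close>, so the renamings here and for \<open>Q'\<close> skip two
    positions.\<close>
  have P': "Rel (Suc (Suc (Suc k))) (\<lambda>xs. P (tl (tl (tl xs))) (hd xs))"
  proof -
    let ?h = "\<lambda>vs. hd vs # tl (tl (tl vs))"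
    have "Rel (Suc (Suc (Suc k))) (\<lambda>xs. P (tl (?h xs)) (hd (?h xs)))"
      by (rule Rel_rename[OF P, where h = ?h]) (auto simp: length_Suc_conv)
    then show ?thesis by simp
  qed
  have Q': "Rel (Suc (Suc (Suc (Suc (Suc k))))) (\<lambda>xs. Q (tl (tl (tl (tl (tl xs)))))
      (hd (tl (tl xs))) (hd (tl xs)) (hd xs))"
  proof -
    let ?h = "\<lambda>vs. hd vs # hd (tl vs) # hd (tl (tl vs)) # tl (tl (tl (tl (tl vs))))"
    have "Rel (Suc (Suc (Suc (Suc (Suc k))))) (\<lambda>xs. Q (tl (tl (tl (?h xs))))
        (hd (tl (tl (?h xs)))) (hd (tl (?h xs))) (hd (?h xs)))"
      by (rule Rel_rename[OF Q, where h = ?h]) (auto simp: length_Suc_conv)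
    then show ?thesis by simp
  qed
  \<comment> \<open>A remainder is not the value of a term. As an argument of \<open>P\<close> or
    \<open>Q\<close> it is replaced by a quantified \<open>y\<close>, tied to it by
    \<open>Rel_mod\<close>.\<close>
  have "Rel k (\<lambda>xs. \<exists>c d.
      (\<exists>y. c mod Suc (Suc 0 * d) = y \<and> P xs y) \<and>
      (\<forall>i. i < n xs \<longrightarrow> (\<exists>y y'. c mod Suc (Suc i * d) = y \<and> c mod Suc (Suc (Suc i) * d) = y' \<and>
        Q xs i y y')) \<and>
      c mod Suc (Suc (n xs) * d) = z xs)"
    by (intro Rel_ex Rel_all Rel_conj Rel_imp Rel_mod Rel_less P' Q' Fn_intros Fn_Suc n z)
  moreover have "(\<exists>c d.
      (\<exists>y. c mod Suc (Suc 0 * d) = y \<and> P xs y) \<and>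
      (\<forall>i. i < n xs \<longrightarrow> (\<exists>y y'. c mod Suc (Suc i * d) = y \<and> c mod Suc (Suc (Suc i) * d) = y' \<and>
        Q xs i y y')) \<and>
      c mod Suc (Suc (n xs) * d) = z xs) \<longleftrightarrow>
    (\<exists>s. P xs (s 0) \<and> (\<forall>i<n xs. Q xs i (s i) (s (Suc i))) \<and> s (n xs) = z xs)"
    (is "?L xs \<longleftrightarrow> ?R xs") for xs
  proof
    assume "?L xs"
    then obtain c d where "P xs (c mod Suc (Suc 0 * d))"
      "\<forall>i<n xs. Q xs i (c mod Suc (Suc i * d)) (c mod Suc (Suc (Suc i) * d))"
      "c mod Suc (Suc (n xs) * d) = z xs" by blast
    then show "?R xs" by (intro exI[of _ "\<lambda>i. c mod Suc (Suc i * d)"]) blast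
  next
    assume "?R xs"
    then obtain s where s: "P xs (s 0)" "\<forall>i<n xs. Q xs i (s i) (s (Suc i))" "s (n xs) = z xs"
      by blast
    obtain c d where "\<forall>i\<le>n xs. c mod Suc (Suc i * d) = s i" by (rule beta_function)
    then have cd: "c mod Suc (Suc i * d) = s i" if "i \<le> n xs" for i using that by blast
    show "?L xs"
    proof (intro exI conjI allI impI)
      show "c mod Suc (Suc 0 * d) = s 0" by (rule cd) simp
      show "c mod Suc (Suc (n xs) * d) = z xs" using cd[of "n xs"] s(3) by simp
      fix i assume i: "i < n xs"
      show "c mod Suc (Suc i * d) = s i" using i by (intro cd) simp
      show "c mod Suc (Suc (Suc i) * d) = s (Suc i)" using i by (intro cd) simp
    qed (use s in auto)
  qed
  ultimately show ?thesis by (simp only:)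
qed

lemma Rel_False: "Rel k (\<lambda>_. False)"
  using Rel_eq[OF Fn_0 Fn_1, of k] by simp

text \<open>The number of inner functions varies, so their results are quantified one by one, by
  induction on \<open>gs\<close>. The list \<open>us\<close> collects the results bound so far,
  while \<open>ts\<close> holds the common arguments.\<close>

lemma Rel_list_all2_comp:
  assumes "\<And>g k ts t. g \<in> set gs \<Longrightarrow> \<forall>t\<in>set ts. Fn k t \<Longrightarrow> Fn k t \<Longrightarrow>
      Rel k (\<lambda>xs. rec_eval g (map (\<lambda>t. t xs) ts) (t xs))"
    and "\<And>k ts t. \<forall>t\<in>set ts. Fn k t \<Longrightarrow> Fn k t \<Longrightarrow>
      Rel k (\<lambda>xs. rec_eval f (map (\<lambda>t. t xs) ts) (t xs))"
    and "\<forall>t\<in>set ts. Fn k t" and "\<forall>t\<in>set us. Fn k t" and "Fn k t"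
  shows "Rel k (\<lambda>xs. \<exists>ys. list_all2 (\<lambda>g. rec_eval g (map (\<lambda>t. t xs) ts)) gs ys \<and>
      rec_eval f (map (\<lambda>t. t xs) us @ ys) (t xs))"
  using assms
proof (induction gs arbitrary: k ts us t)
  case Nil
  show ?case using Nil.prems(2)[of us k t] Nil.prems(4,5) by simp
next
  case (Cons g gs)
  let ?ts = "map (\<lambda>t xs. t (tl xs)) ts" and ?us = "map (\<lambda>t xs. t (tl xs)) us @ [hd]"
  have ts: "\<forall>t\<in>set ?ts. Fn (Suc k) t" and us: "\<forall>t\<in>set ?us. Fn (Suc k) t"
    using Cons.prems(3,4) by (auto intro: Fn_tl Fn_hd)
  have "Rel (Suc k) (\<lambda>xs. rec_eval g (map (\<lambda>t. t xs) ?ts) (hd xs))"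
    using Cons.prems(1)[of g ?ts "Suc k" hd] ts Fn_hd by simp
  moreover have "Rel (Suc k) (\<lambda>xs. \<exists>ys. list_all2 (\<lambda>g. rec_eval g (map (\<lambda>t. t xs) ?ts)) gs ys \<and>
      rec_eval f (map (\<lambda>t. t xs) ?us @ ys) (t (tl xs)))"
    using Cons.prems(1,2) ts us Fn_tl[OF Cons.prems(5)] by (intro Cons.IH) auto
  ultimately have "Rel (Suc k) (\<lambda>xs. rec_eval g (map (\<lambda>t. t (tl xs)) ts) (hd xs) \<and>
      (\<exists>ys. list_all2 (\<lambda>g. rec_eval g (map (\<lambda>t. t (tl xs)) ts)) gs ys \<and>
        rec_eval f (map (\<lambda>t. t (tl xs)) us @ hd xs # ys) (t (tl xs))))"
    using Rel_conj by (force simp: comp_def)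
  then have "Rel k (\<lambda>xs. \<exists>y. rec_eval g (map (\<lambda>t. t xs) ts) y \<and>
      (\<exists>ys. list_all2 (\<lambda>g. rec_eval g (map (\<lambda>t. t xs) ts)) gs ys \<and>
        rec_eval f (map (\<lambda>t. t xs) us @ y # ys) (t xs)))"
    by (rule Rel_ex)
  moreover have "(\<exists>y. rec_eval g (map (\<lambda>t. t xs) ts) y \<and>
      (\<exists>ys. list_all2 (\<lambda>g. rec_eval g (map (\<lambda>t. t xs) ts)) gs ys \<and>
        rec_eval f (map (\<lambda>t. t xs) us @ y # ys) (t xs))) \<longleftrightarrow>
    (\<exists>ys. list_all2 (\<lambda>g. rec_eval g (map (\<lambda>t. t xs) ts)) (g # gs) ys \<and>
      rec_eval f (map (\<lambda>t. t xs) us @ ys) (t xs))" for xs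
    by (auto simp: list_all2_Cons1)
  ultimately show ?case by (simp only:)
qed

text \<open>Arguments and value are arbitrary terms because the induction hypotheses are applied
  below additional quantifiers.\<close>

lemma Rel_rec_eval:
  assumes "\<forall>t\<in>set ts. Fn k t" and "Fn k t"
  shows "Rel k (\<lambda>xs. rec_eval f (map (\<lambda>t. t xs) ts) (t xs))"
  using assms
proof (induction f arbitrary: k ts t)
  case RZero
  then show ?case by (simp add: rec_eval_RZero Rel_eq Fn_0)
next
  case RSucc
  show ?case
  proof (cases "\<exists>u. ts = [u]")
    case True
    then obtain u where "ts = [u]" by blast
    with RSucc show ?thesis by (simp add: rec_eval_RSucc Rel_eq Fn_Suc)
  next
    case False
    \<comment> \<open>Applied to the wrong number of arguments, the successor has an empty
      graph.\<close>
    then have "\<not> rec_eval RSucc (map (\<lambda>t. t xs) ts) (t xs)" for xs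
      by (auto simp: rec_eval_RSucc map_eq_Cons_conv)
    then show ?thesis by (simp add: Rel_False)
  qed
next
  case (RProj i)
  show ?case
  proof (cases "i < length ts")
    case True
    with RProj show ?thesis by (simp add: rec_eval_RProj Rel_eq)
  qed (simp add: rec_eval_RProj Rel_False)
next
  case (RComp f gs)
  show ?case
    using Rel_list_all2_comp[of gs f ts k "[]" t] RComp by (simp add: rec_eval_RComp)
next
  case (RPrim f g)
  show ?case
  proof (cases ts)
    case Nil
    have "\<not> rec_eval (RPrim f g) [] y" for y by (auto elim: rec_eval.cases)
    then show ?thesis by (simp add: Nil Rel_False)
  next
    case (Cons u us)
    let ?us = "map (\<lambda>t xs. t (tl xs)) us"
    let ?us3 = "map (\<lambda>t xs. t (tl (tl (tl xs)))) us"
    have us: "\<forall>t\<in>set us. Fn k t" and u: "Fn k u" using RPrim.prems(1) Cons by auto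
    have "\<forall>t\<in>set ?us. Fn (Suc k) t" using us by (auto intro: Fn_tl)
    then have P: "Rel (Suc k) (\<lambda>xs. rec_eval f (map (\<lambda>t. t (tl xs)) us) (hd xs))"
      using RPrim.IH(1)[of ?us "Suc k" hd] Fn_hd by (simp add: comp_def)
    have "\<forall>t\<in>set ((\<lambda>xs. hd (tl (tl xs))) # (\<lambda>xs. hd (tl xs)) # ?us3). Fn (Suc (Suc (Suc k))) t"
      using us by (auto intro!: Fn_hd Fn_tl[of _ "\<lambda>xs. hd xs"] Fn_tl[of _ "\<lambda>xs. hd (tl xs)"]
        intro: Fn_tl[of _ "\<lambda>xs. f (tl (tl xs))" for f] Fn_tl[of _ "\<lambda>xs. f (tl xs)" for f] Fn_tl)
    from RPrim.IH(2)[OF this Fn_hd]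
    have Q: "Rel (Suc (Suc (Suc k))) (\<lambda>xs. rec_eval g (hd (tl (tl xs)) # hd (tl xs) #
        map (\<lambda>t. t (tl (tl (tl xs)))) us) (hd xs))"
      by (simp add: comp_def)
    show ?thesis
      using Rel_iterate[OF u RPrim.prems(2), of "\<lambda>xs. rec_eval f (map (\<lambda>t. t xs) us)"
          "\<lambda>xs i y. rec_eval g (i # y # map (\<lambda>t. t xs) us)", OF P Q]
      by (simp add: Cons rec_eval_RPrim)
  qed
next
  case (RMin f)
  let ?ts = "map (\<lambda>t xs. t (tl xs)) ts"
  have "Rel k (\<lambda>xs. rec_eval f (map (\<lambda>t. t xs) (t # ts)) 0)"
    using RMin.IH[of "t # ts" k "\<lambda>_. 0"] RMin.prems Fn_0 by simp
  moreover have "Rel k (\<lambda>xs. \<forall>m. m < t xs \<longrightarrow> (\<exists>y. rec_eval f (m # map (\<lambda>t. t xs) ts) (y + 1)))"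
  proof (intro Rel_all Rel_imp Rel_less Rel_ex Fn_intros RMin.prems(2))
    have "\<forall>t\<in>set ((\<lambda>xs. hd (tl xs)) # map (\<lambda>t xs. t (tl (tl xs))) ts). Fn (Suc (Suc k)) t"
      using RMin.prems(1) by (auto intro!: Fn_tl[of _ "\<lambda>xs. hd xs"] Fn_hd
        intro: Fn_tl[of _ "\<lambda>xs. f (tl xs)" for f] Fn_tl)
    from RMin.IH[OF this Fn_add[OF Fn_hd Fn_1]]
    show "Rel (Suc (Suc k)) (\<lambda>xs. rec_eval f (hd (tl xs) # map (\<lambda>t. t (tl (tl xs))) ts) (hd xs + 1))"
      by (simp add: comp_def)
  qed
  ultimately show ?case
    using Rel_conj by (simp add: rec_eval_RMin)
qed

section \<open>Arithmetization of the syntax and diagonalization\<close>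

lemma Rel_prod_encode:
  assumes "Fn k t" "Fn k u" "Fn k v"
  shows "Rel k (\<lambda>xs. prod_encode (t xs, u xs) = v xs)"
proof -
  \<comment> \<open>Doubling clears the division by two in the triangular number of Cantor's pairing
    function.\<close>
  have "Rel k (\<lambda>xs. (t xs + u xs) * (t xs + u xs + 1) + 2 * t xs = 2 * v xs)"
    by (intro Rel_eq Fn_intros assms)
  moreover have "(a + b) * (a + b + 1) + 2 * a = 2 * c \<longleftrightarrow> prod_encode (a, b) = c" for a b c :: nat
  proof -
    have "(a + b) * (a + b + 1) + 2 * a = 2 * prod_encode (a, b)"
      by (simp add: prod_encode_def triangle_def)
    then show ?thesis by simp
  qed
  ultimately show ?thesis by simp
qed

text \<open>The code of a numeral arises by iteration from \<open>prod_encode (1, 0)\<close>, the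
  code of \<open>Zero\<close>. The tag 3 stands for addition and \<open>prod_encode (2, 0)\<close>
  codes \<open>One\<close>.\<close>

lemma Rel_numeral_term_code:
  assumes "Fn k n" "Fn k z"
  shows "Rel k (\<lambda>xs. term_code (numeral_term (n xs)) = z xs)"
proof -
  have "Rel k (\<lambda>xs. \<exists>s. prod_encode (1, 0) = s 0 \<and> (\<forall>i<n xs. \<exists>y y'. prod_encode (2, 0) = y' \<and>
      prod_encode (s i, y') = y \<and> prod_encode (3, y) = s (Suc i)) \<and> s (n xs) = z xs)"
    by (rule Rel_iterate[OF assms]) (intro Rel_ex Rel_conj Rel_prod_encode Fn_intros)+
  moreover have "(\<exists>s. prod_encode (1, 0) = s 0 \<and> (\<forall>i<m. \<exists>y y'. prod_encode (2, 0) = y' \<and>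
      prod_encode (s i, y') = y \<and> prod_encode (3, y) = s (Suc i)) \<and> s m = c) \<longleftrightarrow>
      term_code (numeral_term m) = c" (is "?L \<longleftrightarrow> ?R") for m c
  proof
    assume ?L
    then obtain s where s: "s 0 = prod_encode (1, 0)" "s m = c"
      "\<And>i. i < m \<Longrightarrow> s (Suc i) = prod_encode (3, prod_encode (s i, prod_encode (2, 0)))" by force
    have "i \<le> m \<Longrightarrow> s i = term_code (numeral_term i)" for i
      by (induction i) (simp_all add: s(1,3))
    with s(2) show ?R by simp
  next
    assume ?R
    then show ?L by (intro exI[of _ "\<lambda>i. term_code (numeral_term i)"]) simp
  qed
  ultimately show ?thesis by simp
qed

lemma term_val_numeral_term: "term_val R e (numeral_term n) = enc n"
proof (induction n)
  case (Suc n)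
  have "enc (Suc n) = enc n + 1" using enc_add[of n 1] enc_one by simp
  with Suc show ?case by (simp add: R_simps)
qed (simp add: R_simps enc_zero)

text \<open>A formula obtained from \<open>Rel\<close> may have free variables besides those of its
  arguments. Binding them to zero is a way to close it up to \<open>Var 0\<close>.\<close>

primrec zero_vars :: "nat \<Rightarrow> rform \<Rightarrow> rform" where
  "zero_vars 0 p = p"
| "zero_vars (Suc n) p = FEx (Suc n) (FAnd (FEq (Var (Suc n)) Zero) (zero_vars n p))"

lemma free_vars_zero_vars: "free_vars (zero_vars n p) = free_vars p - {1..n}"
  by (induction n) (auto simp: atLeastAtMostSuc_conv)

lemma satisfies_zero_vars:
  "satisfies R e (zero_vars n p) \<longleftrightarrow> satisfies R (\<lambda>i. if i \<in> {1..n} then 0 else e i) p"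
proof (induction n arbitrary: e)
  case (Suc n)
  have "0 \<in> A" using enc_A[of 0] enc_zero by simp
  then have "satisfies R e (zero_vars (Suc n) p) \<longleftrightarrow> satisfies R (e(Suc n := 0)) (zero_vars n p)"
    by (auto simp: R_simps)
  also have "\<dots> \<longleftrightarrow> satisfies R (\<lambda>i. if i \<in> {1..n} then 0 else (e(Suc n := 0)) i) p"
    by (rule Suc.IH)
  also have "(\<lambda>i. if i \<in> {1..n} then 0 else (e(Suc n := 0)) i) =
      (\<lambda>i. if i \<in> {1..Suc n} then 0 else e i)"
    by (auto simp: fun_eq_iff)
  finally show ?case .
qed simp

text \<open>If \<open>f\<close> decided the theory, some sentence would assert that \<open>f\<close>
  rejects its own code.\<close>

theorem undecidable: "\<not> decidable_theory (first_order_theory R)"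
proof
  define T where "T = form_code ` first_order_theory R"
  assume "decidable_theory (first_order_theory R)"
  then obtain f where f: "\<And>n. rec_eval f [n] (if n \<in> T then 1 else 0)"
    by (auto simp: decidable_theory_def recursive_set_def T_def)
  have f0: "rec_eval f [n] 0 \<longleftrightarrow> n \<notin> T" for n
    using f[of n] rec_eval_unique by fastforce
  \<comment> \<open>If \<open>n\<close> codes a formula, then \<open>h n\<close> codes the assertion
    that this formula holds of \<open>n\<close>. Binding \<open>Var 0\<close> by an equation takes
    the place of substituting the numeral, which keeps the code a simple expression in
    pairings.\<close>
  define h where "h n = prod_encode (3, prod_encode (0, prod_encode (2,
    prod_encode (form_code (FEq (Var 0) (numeral_term n)), n))))" for n
  have rec_f: "Rel k (\<lambda>xs. rec_eval f [t xs] 0)" if "Fn k t" for k t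
    using Rel_rec_eval[of "[t]" k "\<lambda>_. 0" f] that Fn_0 by simp
  have "Fn 1 hd" using Fn_hd[of 0] by simp
  then have "Rel 1 (\<lambda>xs. \<exists>a v b c d g m. term_code (numeral_term (hd xs)) = a \<and>
      prod_encode (0, 0) = v \<and> prod_encode (v, a) = b \<and> prod_encode (0, b) = c \<and>
      prod_encode (c, hd xs) = d \<and> prod_encode (2, d) = g \<and>
      (\<exists>m'. prod_encode (0, g) = m' \<and> prod_encode (3, m') = m) \<and>
      rec_eval f [m] 0)"
    by (intro Rel_ex Rel_conj Rel_prod_encode Rel_numeral_term_code rec_f Fn_intros)
  then have "Rel 1 (\<lambda>xs. rec_eval f [h (hd xs)] 0)"
    by (simp add: h_def)
  from RelE[OF this, of "[0]"]
  obtain p where p: "\<And>r. satisfies R (enc \<circ> r) p \<longleftrightarrow> rec_eval f [h (r 0)] 0"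
    by auto
  define N where "N = Max (insert 0 (free_vars p))"
  define q where "q = zero_vars N p"
  have q0: "free_vars q \<subseteq> {0}"
    using finite_free_vars[of p] by (auto simp: q_def free_vars_zero_vars N_def not_le)
  have q: "satisfies R e q \<longleftrightarrow> h n \<notin> T" if "e 0 = enc n" for e n
  proof -
    let ?r = "(\<lambda>_. 0)(0 := n)"
    have "satisfies R e q \<longleftrightarrow> satisfies R (enc \<circ> ?r) q"
      using q0 that by (intro satisfies_cong) auto
    also have "\<dots> \<longleftrightarrow> satisfies R (enc \<circ> ?r) p"
      unfolding q_def satisfies_zero_vars
      by (rule arg_cong[where f = "\<lambda>e. satisfies R e p"]) (auto simp: enc_zero fun_eq_iff)
    also have "\<dots> \<longleftrightarrow> h n \<notin> T" by (simp add: p f0)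
    finally show ?thesis .
  qed
  \<comment> \<open>The fixed point: \<open>q\<close> is applied to its own code.\<close>
  define n where "n = form_code q"
  define s where "s = FEx 0 (FAnd (FEq (Var 0) (numeral_term n)) q)"
  have "term_vars (numeral_term m) = {}" for m by (induction m) auto
  then have fv: "free_vars s = {}" using q0 by (auto simp: s_def)
  have sat: "satisfies R e s \<longleftrightarrow> h n \<notin> T" for e
  proof -
    have "satisfies R e s \<longleftrightarrow> satisfies R (e(0 := enc n)) q"
      using enc_A[of n] by (auto simp: s_def term_val_numeral_term R_simps)
    then show ?thesis by (simp add: q)
  qed
  have "s \<in> first_order_theory R \<longleftrightarrow> (\<forall>e\<in>UNIV \<rightarrow> A. satisfies R e s)"
    by (simp add: first_order_theory_def fv R_simps(1))
  also have "\<dots> \<longleftrightarrow> (\<forall>e\<in>(UNIV :: nat set) \<rightarrow> A. h n \<notin> T)"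
    by (simp only: sat)
  \<comment> \<open>The set \<open>A\<close> is nonempty, so an assignment exists and the vacuous
    quantifier over assignments disappears.\<close>
  also have "\<dots> \<longleftrightarrow> h n \<notin> T"
    using enc_A by (auto intro: bexI[of _ "\<lambda>_. enc 0"])
  finally have "s \<in> first_order_theory R \<longleftrightarrow> h n \<notin> T" .
  moreover have s: "form_code s = h n" by (simp add: s_def h_def n_def)
  have "h n \<in> T \<longleftrightarrow> s \<in> first_order_theory R"
    unfolding T_def s[symmetric] by (rule inj_image_mem_iff[OF inj_form_code])
  ultimately show False by blast
qed

end

section \<open>Algebraic numbers and algebraic integers form rings\<close>

text \<open>One argument covers two cases: for the inclusion of the integers,
  \<open>integral\<close> means algebraic integer, and for that of the rationals it means algebraic
  number.\<close>

locale hom_to_field = comm_ring_hom hom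
  for hom :: "'a::comm_ring_1 \<Rightarrow> 'b::field"
begin

definition integral :: "'b \<Rightarrow> bool"
  where "integral x \<longleftrightarrow> (\<exists>p. lead_coeff p = 1 \<and> poly (map_poly hom p) x = 0)"

definition hom_span :: "'i set \<Rightarrow> ('i \<Rightarrow> 'b) \<Rightarrow> 'b set"
  where "hom_span I v = {z. \<exists>c. z = (\<Sum>i\<in>I. hom (c i) * v i)}"

lemma hom_span_base:
  assumes "finite I" "i \<in> I"
  shows "v i \<in> hom_span I v"
proof -
  have "(\<Sum>j\<in>I. hom (if j = i then 1 else 0) * v j) = (\<Sum>j\<in>I. if j = i then v j else 0)"
    by (intro sum.cong) auto
  also have "\<dots> = v i" using assms by simp
  finally show ?thesis
    unfolding hom_span_def by (intro CollectI exI[of _ "\<lambda>j. if j = i then 1 else 0"]) simp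
qed

lemma hom_span_add:
  assumes "x \<in> hom_span I v" "y \<in> hom_span I v"
  shows "x + y \<in> hom_span I v"
proof -
  from assms obtain c d where "x = (\<Sum>i\<in>I. hom (c i) * v i)" "y = (\<Sum>i\<in>I. hom (d i) * v i)"
    by (auto simp: hom_span_def)
  then have "x + y = (\<Sum>i\<in>I. hom (c i + d i) * v i)"
    by (simp add: hom_add distrib_right sum.distrib)
  then show ?thesis unfolding hom_span_def by (intro CollectI exI)
qed

lemma hom_span_scale:
  assumes "x \<in> hom_span I v"
  shows "hom a * x \<in> hom_span I v"
proof -
  from assms obtain c where "x = (\<Sum>i\<in>I. hom (c i) * v i)" by (auto simp: hom_span_def)
  then have "hom a * x = (\<Sum>i\<in>I. hom (a * c i) * v i)"
    by (simp add: hom_mult sum_distrib_left mult.assoc)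
  then show ?thesis unfolding hom_span_def by (intro CollectI exI)
qed

lemma hom_span_sum:
  assumes "\<And>j. j \<in> J \<Longrightarrow> f j \<in> hom_span I v"
  shows "(\<Sum>j\<in>J. f j) \<in> hom_span I v"
proof -
  have "0 \<in> hom_span I v"
    unfolding hom_span_def by (intro CollectI exI[of _ "\<lambda>_. 0"]) simp
  then show ?thesis
    using assms by (induction J rule: infinite_finite_induct) (auto intro: hom_span_add)
qed

lemma hom_span_mult:
  assumes "\<And>i. i \<in> I \<Longrightarrow> x * v i \<in> hom_span I v" "z \<in> hom_span I v"
  shows "x * z \<in> hom_span I v"
proof -
  from assms(2) obtain c where "z = (\<Sum>i\<in>I. hom (c i) * v i)" by (auto simp: hom_span_def)
  then have "x * z = (\<Sum>i\<in>I. hom (c i) * (x * v i))"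
    by (simp add: sum_distrib_left mult.left_commute)
  also have "\<dots> \<in> hom_span I v" by (intro hom_span_sum hom_span_scale assms(1))
  finally show ?thesis .
qed

text \<open>A matrix describing the multiplication by \<open>x\<close> has \<open>x\<close> as an eigenvalue.\<close>

lemma integralI_span:
  assumes "finite I" "i0 \<in> I" "v i0 \<noteq> 0"
    and "\<And>i. i \<in> I \<Longrightarrow> x * v i \<in> hom_span I v"
  shows "integral x"
proof -
  define n where "n = card I"
  obtain h where h: "bij_betw h {0..<n} I"
    using ex_bij_betw_nat_finite[OF assms(1)] n_def by blast
  have "\<exists>c. \<forall>i\<in>I. x * v i = (\<Sum>j\<in>I. hom (c i j) * v j)"
    using assms(4) unfolding hom_span_def by (intro bchoice) blast
  then obtain c where c: "\<And>i. i \<in> I \<Longrightarrow> x * v i = (\<Sum>j\<in>I. hom (c i j) * v j)" by blast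
  define A where "A = mat n n (\<lambda>(i, j). c (h i) (h j))"
  define w where "w = vec n (\<lambda>i. v (h i))"
  have A: "A \<in> carrier_mat n n" by (simp add: A_def)
  have hI: "h i \<in> I" if "i < n" for i using h that by (auto simp: bij_betw_def)
  have "map_mat hom A *\<^sub>v w = x \<cdot>\<^sub>v w"
  proof (rule eq_vecI)
    fix i assume i: "i < dim_vec (x \<cdot>\<^sub>v w)"
    then have i: "i < n" by (simp add: w_def)
    have "x * v (h i) = (\<Sum>j\<in>I. hom (c (h i) j) * v j)" by (rule c[OF hI[OF i]])
    also have "\<dots> = (\<Sum>j\<in>{0..<n}. hom (c (h i) (h j)) * v (h j))"
      by (rule sum.reindex_bij_betw[OF h, symmetric])
    finally show "(map_mat hom A *\<^sub>v w) $ i = (x \<cdot>\<^sub>v w) $ i"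
      using i by (simp add: A_def w_def scalar_prod_def)
  qed (simp_all add: A_def w_def)
  moreover have "w \<noteq> 0\<^sub>v n"
  proof
    assume "w = 0\<^sub>v n"
    from assms(2) h obtain i where i: "i < n" "h i = i0" by (auto simp: bij_betw_def)
    have "w $ i = v i0" using i by (simp add: w_def)
    with \<open>w = 0\<^sub>v n\<close> i assms(3) show False by simp
  qed
  ultimately have "eigenvector (map_mat hom A) w x"
    unfolding eigenvector_def by (simp add: A_def w_def)
  then have "eigenvalue (map_mat hom A) x" unfolding eigenvalue_def by blast
  then have "poly (char_poly (map_mat hom A)) x = 0"
    using eigenvalue_root_char_poly[of "map_mat hom A" n x] A by simp
  \<comment> \<open>The entries of \<open>A\<close> lie in the base ring, so its characteristic
    polynomial is a monic equation for \<open>x\<close> over that ring.\<close>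
  then have "poly (map_poly hom (char_poly A)) x = 0" by (simp add: char_poly_hom[OF A])
  moreover have "lead_coeff (char_poly A) = 1" using degree_monic_char_poly[OF A] by simp
  ultimately show ?thesis unfolding integral_def by blast
qed

lemma integral_power_reduce:
  assumes "integral x"
  obtains n c where "n > 0" "x ^ n = (\<Sum>i<n. hom (c i) * x ^ i)"
proof -
  from assms obtain p where p: "lead_coeff p = 1" "poly (map_poly hom p) x = 0"
    by (auto simp: integral_def)
  let ?n = "degree p"
  have "degree (map_poly hom p) = ?n" using p(1) by (intro map_poly_degree_eq) simp
  then have "0 = (\<Sum>i\<le>?n. hom (coeff p i) * x ^ i)"
    using p(2) by (simp add: poly_altdef coeff_map_poly)
  also have "\<dots> = x ^ ?n + (\<Sum>i<?n. hom (coeff p i) * x ^ i)"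
    using p(1) by (simp add: lessThan_Suc_atMost[symmetric])
  finally have *: "x ^ ?n = (\<Sum>i<?n. hom (- coeff p i) * x ^ i)"
    by (simp add: hom_uminus sum_negf eq_neg_iff_add_eq_0)
  \<comment> \<open>In degree 0 the relation would read \<open>1 = 0\<close>.\<close>
  moreover have "?n > 0"
  proof (rule ccontr)
    assume "\<not> ?n > 0"
    with * show False by simp
  qed
  ultimately show ?thesis by (rule that[rotated])
qed

text \<open>The monomials in \<open>x\<close> and \<open>y\<close> with exponents below
  \<open>m\<close> and \<open>n\<close> span a module that is stable under multiplication by
  \<open>x\<close> and by \<open>y\<close>, hence by their sum and product.\<close>

lemma
  assumes "integral x" "integral y"
  shows integral_add: "integral (x + y)" and integral_mult: "integral (x * y)"
proof -
  obtain m c where m: "m > 0" "x ^ m = (\<Sum>i<m. hom (c i) * x ^ i)"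
    by (rule integral_power_reduce[OF assms(1)])
  obtain n d where n: "n > 0" "y ^ n = (\<Sum>i<n. hom (d i) * y ^ i)"
    by (rule integral_power_reduce[OF assms(2)])
  define I where "I = {..<m} \<times> {..<n}"
  define v where "v = (\<lambda>(i, j). x ^ i * y ^ j)"
  have I: "finite I" "(0, 0) \<in> I" "v (0, 0) \<noteq> 0" using m(1) n(1) by (auto simp: I_def v_def)
  have base: "x ^ i * y ^ j \<in> hom_span I v" if "i < m" "j < n" for i j
    using hom_span_base[OF I(1), of "(i, j)" v] that by (simp add: I_def v_def)
  have x: "x * v k \<in> hom_span I v" if k: "k \<in> I" for k
  proof -
    obtain i j where k: "k = (i, j)" "i < m" "j < n" using k by (auto simp: I_def)
    show ?thesis
    proof (cases "Suc i < m")
      case True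
      from base[OF this k(3)] show ?thesis by (simp add: k v_def mult.assoc)
    next
      case False
      then have "Suc i = m" using k by simp
      then have "x * v k = x ^ m * y ^ j" using power_Suc[of x i] by (simp add: k v_def)
      also have "\<dots> = (\<Sum>i<m. hom (c i) * (x ^ i * y ^ j))"
        by (simp add: m(2) sum_distrib_right mult.assoc)
      also have "\<dots> \<in> hom_span I v" by (intro hom_span_sum hom_span_scale base k(3)) simp
      finally show ?thesis .
    qed
  qed
  have y: "y * v k \<in> hom_span I v" if k: "k \<in> I" for k
  proof -
    obtain i j where k: "k = (i, j)" "i < m" "j < n" using k by (auto simp: I_def)
    show ?thesis
    proof (cases "Suc j < n")
      case True
      from base[OF k(2) this] show ?thesis by (simp add: k v_def mult_ac)
    next
      case False
      then have "Suc j = n" using k by simp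
      then have "y * v k = x ^ i * y ^ n" using power_Suc[of y j] by (simp add: k v_def)
      also have "\<dots> = (\<Sum>j<n. hom (d j) * (x ^ i * y ^ j))"
        by (simp add: n(2) sum_distrib_left mult_ac)
      also have "\<dots> \<in> hom_span I v" by (intro hom_span_sum hom_span_scale base k(2)) simp
      finally show ?thesis .
    qed
  qed
  show "integral (x + y)"
    by (rule integralI_span[of I "(0, 0)" v, OF I]) (simp add: distrib_right hom_span_add x y)
  show "integral (x * y)"
    by (rule integralI_span[of I "(0, 0)" v, OF I]) (simp add: mult.assoc hom_span_mult[OF x] y)
qed

end

section \<open>Algebraic integers and algebraic numbers as the two instances\<close>

interpretation of_int_integral: hom_to_field "of_int :: int \<Rightarrow> complex"
  by unfold_locales

interpretation of_rat_integral: hom_to_field "of_rat :: rat \<Rightarrow> complex"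
  by unfold_locales (auto simp: of_rat_add of_rat_mult)

lemma algebraic_int_iff_integral: "algebraic_int (x :: complex) \<longleftrightarrow> of_int_integral.integral x"
  unfolding algebraic_int_altdef_ipoly of_int_integral.integral_def by blast

lemma algebraic_iff_integral: "algebraic (x :: complex) \<longleftrightarrow> of_rat_integral.integral x"
proof
  assume "algebraic x"
  then obtain p where p: "\<And>i. coeff p i \<in> \<rat>" "p \<noteq> 0" "poly p x = 0"
    by (auto simp: algebraic_altdef)
  obtain q where q: "p = map_poly of_rat q" by (rule ratpolyE[OF p(1)])
  have "map_poly of_rat (smult c q) = smult (of_rat c) (map_poly of_rat q :: complex poly)" for c
    by (intro poly_eqI) (simp add: coeff_map_poly of_rat_mult)
  then have "poly (map_poly of_rat (smult (inverse (lead_coeff q)) q)) x = 0"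
    using p(3) by (simp add: q)
  moreover have "lead_coeff (smult (inverse (lead_coeff q)) q) = 1"
    using p(2) q by auto
  ultimately show "of_rat_integral.integral x" unfolding of_rat_integral.integral_def by blast
next
  assume "of_rat_integral.integral x"
  then obtain p where p: "lead_coeff p = 1" "poly (map_poly of_rat p) x = 0"
    by (auto simp: of_rat_integral.integral_def)
  then have "map_poly of_rat p \<noteq> (0 :: complex poly)"
    by (metis lead_coeff_map_poly_nz of_rat_eq_0_iff leading_coeff_0_iff one_neq_zero of_rat_0)
  with p(2) show "algebraic x"
    by (intro algebraicI'[of "map_poly of_rat p"]) (auto simp: coeff_map_poly)
qed

lemma algebraic_add: "algebraic x \<Longrightarrow> algebraic y \<Longrightarrow> algebraic (x + y :: complex)"
  unfolding algebraic_iff_integral by (rule of_rat_integral.integral_add)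

lemma algebraic_mult: "algebraic x \<Longrightarrow> algebraic y \<Longrightarrow> algebraic (x * y :: complex)"
  unfolding algebraic_iff_integral by (rule of_rat_integral.integral_mult)

lemma algebraic_int_add: "algebraic_int x \<Longrightarrow> algebraic_int y \<Longrightarrow> algebraic_int (x + y :: complex)"
  unfolding algebraic_int_iff_integral by (rule of_int_integral.integral_add)

lemma algebraic_int_mult: "algebraic_int x \<Longrightarrow> algebraic_int y \<Longrightarrow> algebraic_int (x * y :: complex)"
  unfolding algebraic_int_iff_integral by (rule of_int_integral.integral_mult)

section \<open>Embeddings of the algebraic numbers\<close>

abbreviation ratp :: "rat poly \<Rightarrow> complex poly"
  where "ratp \<equiv> map_poly of_rat"

lemma ratp_add: "ratp (p + q) = ratp p + ratp q"
  by (intro poly_eqI) (simp add: coeff_map_poly of_rat_add)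

lemma ratp_mult: "ratp (p * q) = ratp p * ratp q"
  by (intro poly_eqI) (simp add: coeff_map_poly coeff_mult of_rat_sum of_rat_mult)

lemma minimal_rat_poly:
  assumes "algebraic x"
  obtains m where "m \<noteq> 0" "poly (ratp m) x = 0" "\<And>q. poly (ratp q) x = 0 \<Longrightarrow> m dvd q"
proof -
  from assms obtain p where "p \<noteq> 0" "\<And>i. coeff p i \<in> \<rat>" "poly p x = 0"
    by (auto simp: algebraic_altdef)
  then obtain p0 where p0: "p0 \<noteq> 0 \<and> poly (ratp p0) x = 0"
    by (metis ratpolyE map_poly_0)
  define m where "m = arg_min degree (\<lambda>p. p \<noteq> 0 \<and> poly (ratp p) x = 0)"
  have m: "m \<noteq> 0 \<and> poly (ratp m) x = 0"
    unfolding m_def using p0 by (rule arg_min_natI)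
  have min: "degree m \<le> degree p" if "p \<noteq> 0 \<and> poly (ratp p) x = 0" for p
    unfolding m_def using that by (rule arg_min_nat_le)
  show ?thesis
  proof (rule that[of m])
    fix q assume q: "poly (ratp q) x = 0"
    have "ratp q = ratp (q div m) * ratp m + ratp (q mod m)"
      by (metis ratp_add ratp_mult div_mult_mod_eq)
    with q m have "poly (ratp (q mod m)) x = 0" by (metis add_0 mult_zero_right poly_add poly_mult)
    then have "q mod m = 0"
      using min[of "q mod m"] degree_mod_less[of m q] m by fastforce
    then show "m dvd q" by (simp add: mod_eq_0_iff_dvd)
  qed (use m in auto)
qed

lemma algebraic_irreducible:
  assumes "algebraic x"
  obtains p where "comm_semiring_1_class.irreducible p" "poly (ratp p) x = 0"
proof -
  obtain m where m: "m \<noteq> 0" "poly (ratp m) x = 0" "\<And>q. poly (ratp q) x = 0 \<Longrightarrow> m dvd q"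
    using minimal_rat_poly[OF assms] by blast
  have "comm_semiring_1_class.irreducible m"
  proof (rule Factorial_Ring.irreducibleI)
    show "\<not> m dvd 1"
    proof
      assume "m dvd 1"
      then obtain c where "m = [:c:]"
        using m(1) is_unit_iff_degree degree_eq_zeroE by metis
      with m(1,2) show False by (simp add: map_poly_pCons)
    qed
    fix a b assume ab: "m = a * b"
    then have "poly (ratp a) x = 0 \<or> poly (ratp b) x = 0"
      using m(2) by (simp add: ratp_mult)
    then show "a dvd 1 \<or> b dvd 1"
    proof
      assume "poly (ratp a) x = 0"
      from m(3)[OF this] ab m(1) have "b dvd 1"
        by (metis dvd_mult_cancel_left mult.right_neutral mult_eq_0_iff)
      then show ?thesis ..
    next
      assume "poly (ratp b) x = 0"
      from m(3)[OF this] ab m(1) have "a dvd 1"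
        by (metis dvd_mult_cancel_left mult.commute mult.right_neutral mult_eq_0_iff)
      then show ?thesis ..
    qed
  qed (rule m(1))
  with m(2) that show ?thesis by blast
qed

text \<open>As an irreducible multiple of the minimal polynomial of \<open>x\<close>,
  \<open>p\<close> is associated with it.\<close>

lemma irreducible_dvd_of_root:
  assumes "comm_semiring_1_class.irreducible p" "poly (ratp p) x = 0" "poly (ratp q) x = 0"
  shows "p dvd q"
proof -
  have "p \<noteq> 0" using assms(1) by auto
  then have "algebraic x"
    using assms(2) by (intro algebraicI'[of "ratp p"]) (auto simp: coeff_map_poly)
  then obtain m where m: "m \<noteq> 0" "poly (ratp m) x = 0" "\<And>q. poly (ratp q) x = 0 \<Longrightarrow> m dvd q"
    using minimal_rat_poly by blast
  obtain k where k: "p = m * k" using m(3)[OF assms(2)] by (auto elim: dvdE)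
  have "\<not> m dvd 1"
  proof
    assume "m dvd 1"
    then obtain c where "m = [:c:]"
        using m(1) is_unit_iff_degree degree_eq_zeroE by metis
    with m(1,2) show False by (simp add: map_poly_pCons)
  qed
  with Factorial_Ring.irreducibleD[OF assms(1) k] have "k dvd 1" by blast
  then have "p dvd m" using k by (simp add: mult_unit_dvd_iff)
  from this m(3)[OF assms(3)] show ?thesis by (rule dvd_trans)
qed

text \<open>Homomorphisms are graphs, so that those with different domains are ordered by inclusion,
  as Zorn's lemma requires. Closure under inverses is derived in
  \<open>partial_hom_inverse\<close>.\<close>

definition partial_hom :: "(complex \<times> complex) set \<Rightarrow> bool"
  where "partial_hom G \<longleftrightarrow>
    (\<forall>a b. (a, b) \<in> G \<longrightarrow> algebraic a) \<and>
    (\<forall>a b c. (a, b) \<in> G \<longrightarrow> (a, c) \<in> G \<longrightarrow> b = c) \<and>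
    (\<forall>q. (of_rat q, of_rat q) \<in> G) \<and>
    (\<forall>a b c d. (a, b) \<in> G \<longrightarrow> (c, d) \<in> G \<longrightarrow> (a + c, b + d) \<in> G) \<and>
    (\<forall>a b c d. (a, b) \<in> G \<longrightarrow> (c, d) \<in> G \<longrightarrow> (a * c, b * d) \<in> G)"

text \<open>For a homomorphism \<open>G\<close> this makes \<open>q\<close> the image of
  \<open>p\<close> under the induced map of polynomial rings.\<close>

definition poly_rel :: "(complex \<times> complex) set \<Rightarrow> complex poly \<Rightarrow> complex poly \<Rightarrow> bool"
  where "poly_rel G p q \<longleftrightarrow> (\<forall>i. (coeff p i, coeff q i) \<in> G)"

lemma algebraic_sum: "(\<And>i. i \<in> I \<Longrightarrow> algebraic (f i :: complex)) \<Longrightarrow> algebraic (\<Sum>i\<in>I. f i)"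
  by (induction I rule: infinite_finite_induct) (auto intro: algebraic_add)

lemma algebraic_power: "algebraic (x :: complex) \<Longrightarrow> algebraic (x ^ n)"
  by (induction n) (auto intro: algebraic_mult rat_imp_algebraic)

lemma algebraic_poly:
  assumes "\<And>i. algebraic (coeff p i)" "algebraic (x :: complex)"
  shows "algebraic (poly p x)"
  unfolding poly_altdef by (intro algebraic_sum algebraic_mult algebraic_power assms)

section \<open>Extension of a homomorphism to one more algebraic number\<close>

context
  fixes G assumes G: "partial_hom G"
begin

lemma partial_hom_algebraic: "(a, b) \<in> G \<Longrightarrow> algebraic a"
  and partial_hom_unique: "(a, b) \<in> G \<Longrightarrow> (a, c) \<in> G \<Longrightarrow> b = c"
  and partial_hom_rat: "(of_rat q, of_rat q) \<in> G"
  and partial_hom_add: "(a, b) \<in> G \<Longrightarrow> (c, d) \<in> G \<Longrightarrow> (a + c, b + d) \<in> G"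
  and partial_hom_mult: "(a, b) \<in> G \<Longrightarrow> (c, d) \<in> G \<Longrightarrow> (a * c, b * d) \<in> G"
  using G unfolding partial_hom_def by blast+

lemma partial_hom_0: "(0, 0) \<in> G" and partial_hom_1: "(1, 1) \<in> G"
  using partial_hom_rat[of 0] partial_hom_rat[of 1] by auto

lemma partial_hom_uminus: "(a, b) \<in> G \<Longrightarrow> (- a, - b) \<in> G"
  using partial_hom_mult[OF partial_hom_rat[of "-1"]] by (simp add: of_rat_minus)

lemma partial_hom_sum: "(\<And>i. i \<in> I \<Longrightarrow> (f i, g i) \<in> G) \<Longrightarrow> ((\<Sum>i\<in>I. f i), (\<Sum>i\<in>I. g i)) \<in> G"
  by (induction I rule: infinite_finite_induct) (auto intro: partial_hom_add partial_hom_0)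

text \<open>The inverse of a nonzero algebraic \<open>a\<close> is a polynomial in \<open>a\<close>
  with rational coefficients, so it lies in the domain already.\<close>

lemma partial_hom_inverse:
  assumes "(a, b) \<in> G" "a \<noteq> 0"
  shows "(inverse a, inverse b) \<in> G"
proof -
  obtain p :: "int poly" where p: "coeff p 0 \<noteq> 0" "poly (map_poly of_int p) a = 0"
    using algebraicE'_nonzero[OF partial_hom_algebraic[OF assms(1)] assms(2)] by blast
  obtain c q where pq: "p = pCons c q" by (cases p)
  \<comment> \<open>The factor comes from solving \<open>c + a * q(a) = 0\<close> for the inverse of
    \<open>a\<close>.\<close>
  define r :: rat where "r = - 1 / of_int c"
  have c: "c \<noteq> 0" using p(1) pq by simp
  have pow: "(a ^ i, b ^ i) \<in> G" for i
    by (induction i) (auto intro: partial_hom_1 partial_hom_mult assms(1))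
  have int: "(of_int k, of_int k) \<in> G" for k
    using partial_hom_rat[of "of_int k"] by simp
  have "(poly (map_poly of_int q) a, poly (map_poly of_int q) b) \<in> G"
    unfolding poly_altdef degree_map_poly[of of_int, simplified]
    by (intro partial_hom_sum partial_hom_mult pow) (simp add: coeff_map_poly int)
  then have q: "(of_rat r * poly (map_poly of_int q) a, of_rat r * poly (map_poly of_int q) b) \<in> G"
    by (rule partial_hom_mult[OF partial_hom_rat])
  have "of_int c + a * poly (map_poly of_int q) a = 0"
    using p(2) unfolding pq by (subst (asm) map_poly_pCons) (use c in auto)
  then have "a * poly (map_poly of_int q) a = - of_int c" by (simp add: eq_neg_iff_add_eq_0 add.commute)
  then have inv: "a * (of_rat r * poly (map_poly of_int q) a) = 1"
    using c by (simp add: r_def of_rat_divide of_rat_minus mult.left_commute)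
  have "b * (of_rat r * poly (map_poly of_int q) b) = 1"
    using partial_hom_mult[OF assms(1) q] inv partial_hom_unique partial_hom_1 by metis
  with inv have "inverse a = of_rat r * poly (map_poly of_int q) a"
    "inverse b = of_rat r * poly (map_poly of_int q) b"
    using inverse_unique by metis+
  with q show ?thesis by simp
qed

lemma poly_rel_add: "poly_rel G p p' \<Longrightarrow> poly_rel G q q' \<Longrightarrow> poly_rel G (p + q) (p' + q')"
  unfolding poly_rel_def by (auto intro: partial_hom_add)

lemma poly_rel_mult: "poly_rel G p p' \<Longrightarrow> poly_rel G q q' \<Longrightarrow> poly_rel G (p * q) (p' * q')"
  unfolding poly_rel_def by (auto simp: coeff_mult intro!: partial_hom_sum partial_hom_mult)

lemma poly_rel_diff: "poly_rel G p p' \<Longrightarrow> poly_rel G q q' \<Longrightarrow> poly_rel G (p - q) (p' - q')"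
  unfolding poly_rel_def using partial_hom_add partial_hom_uminus
  by (metis (no_types, lifting) add_uminus_conv_diff coeff_diff)

lemma poly_rel_monom: "(a, b) \<in> G \<Longrightarrow> poly_rel G (monom a n) (monom b n)"
  unfolding poly_rel_def by (auto intro: partial_hom_0)

lemma poly_rel_0: "poly_rel G 0 p \<Longrightarrow> p = 0"
  unfolding poly_rel_def by (intro poly_eqI) (metis coeff_0 partial_hom_unique partial_hom_0)

text \<open>Division by a monic polynomial uses only ring operations on coefficients, so it can be
  carried out on both sides of the homomorphism at once.\<close>

lemma poly_rel_division:
  assumes "poly_rel G m m'" "lead_coeff m = 1" "degree m > 0" "poly_rel G q q'"
  obtains s s' r r' where "q = s * m + r" "q' = s' * m' + r'"
    "poly_rel G r r'" "degree r < degree m"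
  using assms(4)
proof (induction "degree q" arbitrary: q q' thesis rule: less_induct)
  case less
  show ?case
  proof (cases "degree q < degree m")
    case True
    then show ?thesis using less.prems(1)[of 0 q 0 q'] less.prems(2) by simp
  next
    case False
    define d where "d = degree q - degree m"
    define t where "t = monom (lead_coeff q) d"
    \<comment> \<open>Taken at \<open>degree q\<close>, this coefficient is the image of
      \<open>lead_coeff q\<close>.\<close>
    define t' where "t' = monom (coeff q' (degree q)) d"
    have t: "poly_rel G t t'"
      unfolding t_def t'_def using less.prems(2) by (intro poly_rel_monom) (simp add: poly_rel_def)
    have rel: "poly_rel G (q - t * m) (q' - t' * m')"
      by (intro poly_rel_diff poly_rel_mult t assms(1) less.prems(2))
    have q0: "q \<noteq> 0" using False assms(3) by auto
    have deg: "degree (t * m) = degree q"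
    proof -
      have "t \<noteq> 0" "degree t = d" using q0 by (auto simp: t_def degree_monom_eq)
      moreover have "m \<noteq> 0" using assms(2) by auto
      ultimately show ?thesis using False by (simp add: degree_mult_eq d_def)
    qed
    have "coeff (t * m) (degree q) = lead_coeff t * lead_coeff m"
      unfolding deg[symmetric] by (rule lead_coeff_mult)
    then have "coeff (q - t * m) (degree q) = 0"
      using assms(2) q0 by (simp add: t_def degree_monom_eq)
    moreover have "degree (q - t * m) \<le> degree q"
      using deg by (metis degree_diff_le order_refl)
    moreover have "degree q > 0" using False assms(3) by simp
    ultimately have "degree (q - t * m) < degree q"
      by (metis eq_zero_or_degree_less degree_0)
    from less.hyps[OF this _ rel] obtain s s' r r' where
      "q - t * m = s * m + r" "q' - t' * m' = s' * m' + r'" "poly_rel G r r'" "degree r < degree m"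
      by blast
    then show ?thesis
      using less.prems(1)[of "t + s" r "t' + s'" r'] by (simp add: algebra_simps)
  qed
qed

text \<open>The extension sends \<open>p(x)\<close> to \<open>p'(y)\<close> for related
  \<open>p\<close> and \<open>p'\<close>, and the second assumption makes this well defined.\<close>

lemma partial_hom_extend:
  assumes "algebraic x"
    and *: "\<And>q q'. poly_rel G q q' \<Longrightarrow> poly q x = 0 \<Longrightarrow> poly q' y = 0"
  shows "\<exists>G'. partial_hom G' \<and> G \<subseteq> G' \<and> (x, y) \<in> G'"
proof -
  define G' where "G' = {(poly p x, poly p' y) | p p'. poly_rel G p p'}"
  have const: "(a, b) \<in> G'" if "(a, b) \<in> G" for a b
    using poly_rel_monom[OF that, of 0] unfolding G'_def by (force simp: poly_monom)
  have alg: "algebraic a" if "(a, b) \<in> G'" for a b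
    using that partial_hom_algebraic unfolding G'_def poly_rel_def
    by (auto intro!: algebraic_poly assms(1))
  have uniq: "b = c" if "(a, b) \<in> G'" "(a, c) \<in> G'" for a b c
  proof -
    from that obtain p p' q q' where "poly_rel G p p'" "poly_rel G q q'"
      "poly p x = a" "poly q x = a" "poly p' y = b" "poly q' y = c" by (auto simp: G'_def)
    then show ?thesis using *[OF poly_rel_diff[of p p' q q']] by simp
  qed
  have add: "(a + c, b + d) \<in> G'" if "(a, b) \<in> G'" "(c, d) \<in> G'" for a b c d
  proof -
    from that obtain p p' q q' where "poly_rel G p p'" "poly_rel G q q'"
      "poly p x = a" "poly q x = c" "poly p' y = b" "poly q' y = d" by (auto simp: G'_def)
    then show ?thesis unfolding G'_def using poly_rel_add[of p p' q q'] by force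
  qed
  have mult: "(a * c, b * d) \<in> G'" if "(a, b) \<in> G'" "(c, d) \<in> G'" for a b c d
  proof -
    from that obtain p p' q q' where "poly_rel G p p'" "poly_rel G q q'"
      "poly p x = a" "poly q x = c" "poly p' y = b" "poly q' y = d" by (auto simp: G'_def)
    then show ?thesis unfolding G'_def using poly_rel_mult[of p p' q q'] by force
  qed
  have "partial_hom G'"
    unfolding partial_hom_def using alg uniq add mult const[OF partial_hom_rat] by blast
  moreover have "(x, y) \<in> G'"
    unfolding G'_def using poly_rel_monom[OF partial_hom_1, of 1] by (force simp: poly_monom)
  ultimately show ?thesis using const by auto
qed

text \<open>The value \<open>y\<close> is a root of the image of the minimal polynomial of
  \<open>x\<close> over the domain of \<open>G\<close>. Division with remainder by that polynomial
  shows that \<open>y\<close> is admissible.\<close>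

lemma partial_hom_extend_exists:
  assumes x: "algebraic x"
  shows "\<exists>G' y. partial_hom G' \<and> G \<subseteq> G' \<and> (x, y) \<in> G'"
proof -
  define P where "P = (\<lambda>p. p \<noteq> 0 \<and> poly p x = 0 \<and> (\<exists>p'. poly_rel G p p'))"
  from x obtain p0 where p0: "p0 \<noteq> 0" "poly (ratp p0) x = 0" by (rule minimal_rat_poly)
  have "P (ratp p0)"
    unfolding P_def poly_rel_def using p0 partial_hom_rat
    by (auto simp: coeff_map_poly intro!: exI[of _ "ratp p0"])
  define n where "n = arg_min degree P"
  have n: "P n" unfolding n_def using \<open>P (ratp p0)\<close> by (rule arg_min_natI)
  have min: "degree n \<le> degree p" if "P p" for p
    unfolding n_def using that by (rule arg_min_nat_le)
  from n obtain n' where n': "poly_rel G n n'" by (auto simp: P_def)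
  define c where "c = inverse (lead_coeff n)"
  define c' where "c' = inverse (coeff n' (degree n))"
  define m where "m = monom c 0 * n"
  define m' where "m' = monom c' 0 * n'"
  have n0: "n \<noteq> 0" "lead_coeff n \<noteq> 0" using n by (auto simp: P_def)
  have "(c, c') \<in> G"
    unfolding c_def c'_def using n' n0 by (intro partial_hom_inverse) (auto simp: poly_rel_def)
  then have rel: "poly_rel G m m'"
    unfolding m_def m'_def by (intro poly_rel_mult poly_rel_monom n')
  have c0: "c \<noteq> 0" using n0 by (simp add: c_def)
  have m_n: "m = smult c n" by (simp add: m_def monom_0)
  have deg: "degree m = degree n" using c0 by (simp add: m_n)
  have monic: "lead_coeff m = 1" using n0 by (simp add: m_n c_def)
  have root: "poly m x = 0" using n by (simp add: m_n P_def)
  have deg_pos: "degree m > 0"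
  proof (rule ccontr)
    assume "\<not> degree m > 0"
    then have "m = 1" using monic by (metis degree_0_id gr0I of_nat_1 one_pCons pCons_one)
    with root show False by simp
  qed
  \<comment> \<open>Since 1 is mapped to 1 and 0 to 0, the image of the monic \<open>m\<close> keeps
    its positive degree and thus has a complex root.\<close>
  have "coeff m' (degree m) = 1"
    using rel monic partial_hom_unique partial_hom_1 unfolding poly_rel_def by metis
  moreover have "coeff m' i = 0" if "i > degree m" for i
    using rel that partial_hom_unique partial_hom_0 coeff_eq_0 unfolding poly_rel_def by metis
  ultimately have "degree m' = degree m"
    by (intro antisym degree_le le_degree) auto
  then have "\<not> constant (poly m')" using deg_pos by (simp add: constant_degree)
  then obtain y where y: "poly m' y = 0" using fundamental_theorem_of_algebra by blast
  have "poly q' y = 0" if q: "poly_rel G q q'" "poly q x = 0" for q q'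
  proof -
    obtain s s' r r' where sr: "q = s * m + r" "q' = s' * m' + r'"
      "poly_rel G r r'" "degree r < degree m"
      by (rule poly_rel_division[OF rel monic deg_pos q(1)])
    have "r = 0"
    proof (rule ccontr)
      assume "r \<noteq> 0"
      moreover have "poly r x = 0" using sr(1) q(2) root by simp
      ultimately have "P r" using sr(3) by (auto simp: P_def)
      with min sr(4) deg show False by force
    qed
    with sr(2,3) y show ?thesis using poly_rel_0[of r'] by simp
  qed
  with partial_hom_extend[OF x] show ?thesis by blast
qed

end

text \<open>An embedding of the field of algebraic numbers into the complex numbers, extended
  arbitrarily to transcendental arguments.\<close>

definition embedding :: "(complex \<Rightarrow> complex) \<Rightarrow> bool"
  where "embedding \<sigma> \<longleftrightarrow> \<sigma> 1 = 1 \<and> (\<forall>a b. algebraic a \<longrightarrow> algebraic b \<longrightarrow>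
    \<sigma> (a + b) = \<sigma> a + \<sigma> b \<and> \<sigma> (a * b) = \<sigma> a * \<sigma> b)"

text \<open>The domain of a maximal homomorphism from Zorn's lemma contains every algebraic number,
  as it could be enlarged otherwise.\<close>

lemma partial_hom_imp_embedding:
  assumes "partial_hom G0"
  obtains \<sigma> where "embedding \<sigma>" "\<And>a b. (a, b) \<in> G0 \<Longrightarrow> \<sigma> a = b"
proof -
  define \<H> where "\<H> = {G. partial_hom G \<and> G0 \<subseteq> G}"
  have "\<exists>M\<in>\<H>. \<forall>N\<in>\<H>. M \<subseteq> N \<longrightarrow> N = M"
  proof (rule subset_Zorn_nonempty)
    fix \<C> assume C: "\<C> \<noteq> {}" "subset.chain \<H> \<C>"
    then have sub: "\<And>G. G \<in> \<C> \<Longrightarrow> partial_hom G \<and> G0 \<subseteq> G"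
      by (auto simp: \<H>_def subset_chain_def)
    \<comment> \<open>Each condition on a homomorphism concerns at most two given pairs, and these
      lie in a common member of the chain.\<close>
    have common: "\<exists>G\<in>\<C>. u \<in> G \<and> v \<in> G" if "u \<in> \<Union>\<C>" "v \<in> \<Union>\<C>" for u v
      using that C(2) unfolding subset_chain_def by blast
    have "partial_hom (\<Union>\<C>)"
      unfolding partial_hom_def
    proof (intro conjI allI impI)
      fix a b assume "(a, b) \<in> \<Union>\<C>"
      then show "algebraic a" using sub partial_hom_algebraic by blast
    next
      fix a b c assume "(a, b) \<in> \<Union>\<C>" "(a, c) \<in> \<Union>\<C>"
      from common[OF this] sub partial_hom_unique show "b = c" by blast
    next
      fix q show "(of_rat q, of_rat q) \<in> \<Union>\<C>" using C(1) sub partial_hom_rat by blast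
    next
      fix a b c d assume "(a, b) \<in> \<Union>\<C>" "(c, d) \<in> \<Union>\<C>"
      from common[OF this] sub partial_hom_add show "(a + c, b + d) \<in> \<Union>\<C>" by blast
    next
      fix a b c d assume "(a, b) \<in> \<Union>\<C>" "(c, d) \<in> \<Union>\<C>"
      from common[OF this] sub partial_hom_mult show "(a * c, b * d) \<in> \<Union>\<C>" by blast
    qed
    with C(1) sub show "\<Union>\<C> \<in> \<H>" unfolding \<H>_def by blast
  qed (use assms in \<open>auto simp: \<H>_def\<close>)
  then obtain M where M: "partial_hom M" "G0 \<subseteq> M"
    and max: "\<And>N. partial_hom N \<Longrightarrow> M \<subseteq> N \<Longrightarrow> N = M"
    unfolding \<H>_def by (metis (no_types, lifting) mem_Collect_eq subset_trans)
  have dom: "\<exists>y. (x, y) \<in> M" if "algebraic x" for x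
    using partial_hom_extend_exists[OF M(1) that] max by blast
  define \<sigma> where "\<sigma> a = (THE b. (a, b) \<in> M)" for a
  have \<sigma>: "\<sigma> a = b" if "(a, b) \<in> M" for a b
    unfolding \<sigma>_def using that partial_hom_unique[OF M(1)] by blast
  have "embedding \<sigma>"
    unfolding embedding_def
    using \<sigma> dom partial_hom_1[OF M(1)] partial_hom_add[OF M(1)] partial_hom_mult[OF M(1)] by metis
  with that \<sigma> M(2) show ?thesis by blast
qed

text \<open>The identity of the rationals extends by \<open>x\<close> going to \<open>y\<close>,
  because every rational polynomial vanishing at \<open>x\<close> is a multiple of
  \<open>p\<close>.\<close>

theorem conjugate_embedding:
  assumes "conjugate_over_Q x y"
  obtains \<sigma> where "embedding \<sigma>" "\<sigma> x = y"
proof -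
  from assms obtain p :: "rat poly" where p: "comm_semiring_1_class.irreducible p"
    "poly (ratp p) x = 0" "poly (ratp p) y = 0" by (auto simp: conjugate_over_Q_def)
  define G where "G = {(a, a) | a :: complex. a \<in> \<rat>}"
  have G: "partial_hom G"
    unfolding partial_hom_def G_def by (auto intro: rat_imp_algebraic)
  have "p \<noteq> 0" using p(1) by auto
  then have x: "algebraic x"
    using p(2) by (intro algebraicI'[of "ratp p"]) (auto simp: coeff_map_poly)
  have "\<And>q q'. poly_rel G q q' \<Longrightarrow> poly q x = 0 \<Longrightarrow> poly q' y = 0"
  proof -
    fix q q' assume that: "poly_rel G q q'" "poly q x = 0"
    from that(1) have "q' = q" "\<And>i. coeff q i \<in> \<rat>"
      by (auto simp: poly_rel_def G_def poly_eq_iff)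
    then obtain r where r: "q = ratp r" using ratpolyE by blast
    with that(2) irreducible_dvd_of_root[OF p(1,2)] obtain k where "r = p * k" by (auto elim: dvdE)
    with p(3) r \<open>q' = q\<close> show "poly q' y = 0" by (simp add: ratp_mult)
  qed
  then obtain G' where "partial_hom G'" "(x, y) \<in> G'"
    using partial_hom_extend[OF G x, of y] by blast
  with partial_hom_imp_embedding that show ?thesis by metis
qed

section \<open>Arithmetic of embeddings\<close>

context
  fixes \<sigma> assumes \<sigma>: "embedding \<sigma>"
begin

lemma embedding_add: "algebraic a \<Longrightarrow> algebraic b \<Longrightarrow> \<sigma> (a + b) = \<sigma> a + \<sigma> b"
  and embedding_mult: "algebraic a \<Longrightarrow> algebraic b \<Longrightarrow> \<sigma> (a * b) = \<sigma> a * \<sigma> b"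
  and embedding_1: "\<sigma> 1 = 1"
  using \<sigma> by (simp_all add: embedding_def)

lemma embedding_0: "\<sigma> 0 = 0"
  using embedding_add[of 0 0] by simp

lemma embedding_uminus: "algebraic a \<Longrightarrow> \<sigma> (- a) = - \<sigma> a"
  using embedding_add[of a "- a"] embedding_0 by (simp add: eq_neg_iff_add_eq_0 add.commute)

lemma embedding_diff: "algebraic a \<Longrightarrow> algebraic b \<Longrightarrow> \<sigma> (a - b) = \<sigma> a - \<sigma> b"
  using embedding_add[of a "- b"] embedding_uminus[of b] by simp

lemma embedding_of_nat: "\<sigma> (of_nat n) = of_nat n"
  by (induction n) (simp_all add: embedding_0 embedding_1 embedding_add rat_imp_algebraic)

lemma embedding_of_int: "\<sigma> (of_int n) = of_int n"
  by (cases n rule: int_cases2) (simp_all add: embedding_of_nat embedding_uminus rat_imp_algebraic)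

lemma embedding_eq_0:
  assumes "algebraic a" "\<sigma> a = 0"
  shows "a = 0"
proof (rule ccontr)
  assume "a \<noteq> 0"
  then have "\<sigma> a * \<sigma> (inverse a) = 1"
    using embedding_mult[of a "inverse a"] assms(1) embedding_1 by auto
  with assms(2) show False by simp
qed

lemma embedding_of_rat: "\<sigma> (of_rat q) = of_rat q"
proof -
  obtain a b where q: "q = of_int a / of_int b" "b > 0"
    by (metis Rat_cases Fract_of_int_quotient)
  then have q': "of_rat q = of_int a / (of_int b :: complex)" by (simp add: of_rat_divide)
  then have "\<sigma> (of_rat q * of_int b) = \<sigma> (of_int a)" using q by simp
  then have "\<sigma> (of_rat q) * of_int b = of_int a"
    by (simp add: embedding_mult rat_imp_algebraic embedding_of_int)
  then show ?thesis using q(2) unfolding q' by (simp add: eq_divide_eq)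
qed

lemma embedding_ratp:
  assumes "algebraic a"
  shows "\<sigma> (poly (ratp p) a) = poly (ratp p) (\<sigma> a)"
proof (induction p)
  case (pCons c p)
  have "algebraic (poly (ratp p) a)"
    by (intro algebraic_poly assms) (simp add: coeff_map_poly rat_imp_algebraic)
  moreover have "algebraic (of_rat c :: complex)" by (rule rat_imp_algebraic) simp
  ultimately show ?case
    using pCons assms by (simp add: map_poly_pCons embedding_add embedding_mult embedding_of_rat algebraic_mult)
qed (simp add: embedding_0)

lemma embedding_conjugate:
  assumes "algebraic a"
  shows "conjugate_over_Q a (\<sigma> a)"
proof -
  obtain p :: "rat poly" where "comm_semiring_1_class.irreducible p" "poly (ratp p) a = 0"
    using algebraic_irreducible[OF assms] by blast
  then show ?thesis
    unfolding conjugate_over_Q_def using embedding_ratp[OF assms, of p] embedding_0 by auto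
qed

lemma embedding_algebraic_int:
  assumes "algebraic_int a"
  shows "algebraic_int (\<sigma> a)"
proof -
  obtain p where p: "poly (map_poly of_int p) a = 0" "lead_coeff p = 1"
    using assms by (auto simp: algebraic_int_altdef_ipoly)
  have "map_poly of_int p = ratp (map_poly of_int p)"
    by (intro poly_eqI) (simp add: coeff_map_poly)
  then have "poly (map_poly of_int p) (\<sigma> a) = 0"
    using embedding_ratp[of a "map_poly of_int p"] assms p(1) embedding_0 by auto
  with p(2) show ?thesis by (auto simp: algebraic_int_altdef_ipoly)
qed

lemma embedding_prod:
  assumes "\<And>i. i \<in> I \<Longrightarrow> algebraic (f i)"
  shows "\<sigma> (\<Prod>i\<in>I. f i) = (\<Prod>i\<in>I. \<sigma> (f i)) \<and> algebraic (\<Prod>i\<in>I. f i)"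
  using assms
  by (induction I rule: infinite_finite_induct)
    (auto simp: embedding_1 embedding_mult rat_imp_algebraic intro: algebraic_mult)

end

section \<open>Vanishing of algebraic integers with small conjugates\<close>

lemma norm_prod_mset_less_1:
  fixes A :: "complex multiset"
  assumes "A \<noteq> {#}" "\<And>y. y \<in># A \<Longrightarrow> cmod y < 1"
  shows "cmod (\<Prod>y\<in>#A. - y) < 1"
  using assms
proof (induction A)
  case (add a A)
  have "cmod (\<Prod>y\<in>#A. - y) \<le> 1"
    using add by (cases "A = {#}") (auto intro: less_imp_le)
  moreover have "cmod a < 1" using add.prems by simp
  ultimately have "cmod a * cmod (\<Prod>y\<in>#A. - y) < 1"
    by (metis mult_left_le norm_ge_zero order_le_less_trans)
  then show ?case by (simp add: norm_mult)
qed simp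

lemma algebraic_int_prod_mset:
  fixes A :: "complex multiset"
  shows "(\<And>y. y \<in># A \<Longrightarrow> algebraic_int y) \<Longrightarrow> algebraic_int (\<Prod>y\<in>#A. - y)"
  by (induction A) (auto intro: algebraic_int_mult)

text \<open>The product of the negated conjugates is an algebraic integer and, as a quotient of two
  coefficients of \<open>p\<close>, rational. An integer of absolute value below 1 is zero, so some
  conjugate is zero and \<open>x\<close> with it.\<close>

theorem algebraic_int_small_eq_0:
  fixes x :: complex
  assumes x: "algebraic_int x" and small: "\<And>\<sigma>. embedding \<sigma> \<Longrightarrow> cmod (\<sigma> x) < 1"
  shows "x = 0"
proof -
  obtain p :: "rat poly" where p: "comm_semiring_1_class.irreducible p" "poly (ratp p) x = 0"
    using algebraic_irreducible x by blast
  have "p \<noteq> 0" using p(1) by auto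
  then have p0: "ratp p \<noteq> 0" by simp
  then obtain A where A: "ratp p = smult (lead_coeff (ratp p)) (\<Prod>y\<in>#A. [:- y, 1:])"
    using alg_closed_imp_factorization by blast
  have root: "poly (ratp p) y = 0 \<longleftrightarrow> y \<in># A" for y
  proof -
    have "poly (\<Prod>y\<in>#B. [:- y, 1:]) y = 0 \<longleftrightarrow> y \<in># B" for B :: "complex multiset"
      by (induction B) auto
    with A p0 show ?thesis by (metis leading_coeff_0_iff mult_eq_0_iff poly_smult)
  qed
  have emb: "\<exists>\<sigma>. embedding \<sigma> \<and> \<sigma> x = y" if "y \<in># A" for y
    using that p root conjugate_embedding[of x y] unfolding conjugate_over_Q_def by metis
  have "cmod (\<Prod>y\<in>#A. - y) < 1"
    using small emb p(2) root by (intro norm_prod_mset_less_1) auto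
  moreover have "(\<Prod>y\<in>#A. - y) \<in> \<int>"
  proof (rule rational_algebraic_int_is_int)
    show "algebraic_int (\<Prod>y\<in>#A. - y)"
      using emb embedding_algebraic_int x by (intro algebraic_int_prod_mset) metis
    have "poly (\<Prod>y\<in>#B. [:- y, 1:]) 0 = (\<Prod>y\<in>#B. - y)" for B :: "complex multiset"
      by (induction B) auto
    then have "poly (ratp p) 0 = lead_coeff (ratp p) * (\<Prod>y\<in>#A. - y)"
      using A by (metis poly_smult)
    then have "(\<Prod>y\<in>#A. - y) = coeff (ratp p) 0 / lead_coeff (ratp p)"
      using p0 by (simp add: poly_0_coeff_0 field_simps)
    then show "(\<Prod>y\<in>#A. - y) \<in> \<rat>" by (simp add: coeff_map_poly)
  qed
  then obtain z where z: "(\<Prod>y\<in>#A. - y) = of_int z" by (rule Ints_cases)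
  ultimately have "(\<Prod>y\<in>#A. - y) = 0"
    unfolding z norm_of_int by simp
  then have "0 \<in># A" by (auto simp: prod_mset_zero_iff)
  with emb obtain \<sigma> where "embedding \<sigma>" "\<sigma> x = 0" by blast
  with x show ?thesis using embedding_eq_0 by blast
qed

section \<open>Subfields of the complex numbers\<close>

lemma CC_simps:
  "carrier CC = UNIV" "\<zero>\<^bsub>CC\<^esub> = 0" "\<one>\<^bsub>CC\<^esub> = 1" "x \<oplus>\<^bsub>CC\<^esub> y = x + y" "x \<otimes>\<^bsub>CC\<^esub> y = x * y"
  by (simp_all add: ring_of_type_algebra_def)

lemma field_CC: "Ring.field CC"
  by (rule field_from_type_algebra)

interpretation CC: Ring.cring CC
  by (rule cring_from_type_algebra)

lemma CC_a_inv: "\<ominus>\<^bsub>CC\<^esub> x = - x"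
  by (rule CC.minus_equality) (simp_all add: CC_simps)

lemma CC_m_inv: "x \<noteq> 0 \<Longrightarrow> inv\<^bsub>CC\<^esub> x = inverse x"
  by (rule CC.comm_inv_char) (simp_all add: CC_simps)

text \<open>Because of \<open>inverse 0 = 0\<close>, closure under inverses can be asked of all
  elements.\<close>

lemma subfield_CC_iff:
  "subfield F CC \<longleftrightarrow> 1 \<in> F \<and> (\<forall>x\<in>F. - x \<in> F \<and> inverse x \<in> F) \<and>
    (\<forall>x\<in>F. \<forall>y\<in>F. x + y \<in> F \<and> x * y \<in> F)"
proof
  assume F: "subfield F CC"
  have r: "subring F CC" by (rule subfieldE(1)[OF F])
  have "inverse x \<in> F" if "x \<in> F" for x
    using ring.subfield_m_inv[OF CC.ring_axioms F, of x] that subringE(2)[OF r] CC_m_inv[of x]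
    by (cases "x = 0") (auto simp: CC_simps)
  then show "1 \<in> F \<and> (\<forall>x\<in>F. - x \<in> F \<and> inverse x \<in> F) \<and>
      (\<forall>x\<in>F. \<forall>y\<in>F. x + y \<in> F \<and> x * y \<in> F)"
    using subringE(3,5,6,7)[OF r] by (auto simp: CC_simps CC_a_inv)
next
  assume F: "1 \<in> F \<and> (\<forall>x\<in>F. - x \<in> F \<and> inverse x \<in> F) \<and>
    (\<forall>x\<in>F. \<forall>y\<in>F. x + y \<in> F \<and> x * y \<in> F)"
  show "subfield F CC"
  proof (rule field.subfieldI'[OF field_CC])
    show "subring F CC"
      by (rule CC.subringI) (use F in \<open>auto simp: CC_simps CC_a_inv\<close>)
  qed (use F CC_m_inv in \<open>auto simp: CC_simps\<close>)
qed

context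
  fixes F assumes F: "subfield F CC"
begin

lemma subfield_1: "1 \<in> F"
  and subfield_uminus: "x \<in> F \<Longrightarrow> - x \<in> F"
  and subfield_inverse: "x \<in> F \<Longrightarrow> inverse x \<in> F"
  and subfield_add: "x \<in> F \<Longrightarrow> y \<in> F \<Longrightarrow> x + y \<in> F"
  and subfield_mult: "x \<in> F \<Longrightarrow> y \<in> F \<Longrightarrow> x * y \<in> F"
  using F unfolding subfield_CC_iff by blast+

lemma subfield_diff: "x \<in> F \<Longrightarrow> y \<in> F \<Longrightarrow> x - y \<in> F"
  using subfield_add[of x "- y"] subfield_uminus by simp

lemma subfield_divide: "x \<in> F \<Longrightarrow> y \<in> F \<Longrightarrow> x / y \<in> F"
  using subfield_mult[of x "inverse y"] subfield_inverse by (simp add: divide_inverse)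

lemma subfield_0: "0 \<in> F"
  using subfield_diff[OF subfield_1 subfield_1] by simp

lemma subfield_of_nat: "of_nat n \<in> F"
  by (induction n) (auto intro: subfield_0 subfield_1 subfield_add)

lemma subfield_numeral: "numeral n \<in> F"
  using subfield_of_nat[of "numeral n"] by simp

lemmas subfield_intros = subfield_1 subfield_uminus subfield_inverse subfield_add subfield_mult
  subfield_diff subfield_divide subfield_0 subfield_of_nat subfield_numeral

lemma subfield_adjoin_sqrt:
  assumes "r * r \<in> F" "r \<notin> F"
  shows "subfield {a + b * r | a b. a \<in> F \<and> b \<in> F} CC"
    (is "subfield ?E CC")
  unfolding subfield_CC_iff
proof (intro conjI ballI)
  show "1 \<in> ?E" using subfield_0 subfield_1 by force
next
  fix x assume "x \<in> ?E"
  then obtain a b where x: "x = a + b * r" "a \<in> F" "b \<in> F" by blast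
  have "- x = - a + (- b) * r" by (simp add: x)
  then show "- x \<in> ?E" using x subfield_uminus by blast
  show "inverse x \<in> ?E"
  proof (cases "a = 0 \<and> b = 0")
    case True
    then show ?thesis using x subfield_0 by force
  next
    case False
    \<comment> \<open>This is the product of \<open>x\<close> with its conjugate
      \<open>a - b * r\<close>. Neither factor vanishes, since otherwise \<open>r\<close> would lie
      in \<open>F\<close>.\<close>
    define d where "d = a * a - b * b * (r * r)"
    have "a - b * r \<noteq> 0"
    proof
      assume *: "a - b * r = 0"
      show False
      proof (cases "b = 0")
        case False
        with * have "r = a / b" by (simp add: field_simps)
        with assms(2) x subfield_divide show False by blast
      qed (use False * in auto)
    qed
    moreover have "a + b * r \<noteq> 0"
    proof
      assume *: "a + b * r = 0"
      show False
      proof (cases "b = 0")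
        case False
        with * have "r = - a / b" by (simp add: field_simps eq_neg_iff_add_eq_0)
        with assms(2) x subfield_divide subfield_uminus show False by blast
      qed (use False * in auto)
    qed
    moreover have d: "d = (a + b * r) * (a - b * r)" by (simp add: d_def algebra_simps)
    ultimately have "inverse x = (a - b * r) / d"
      unfolding x d by (simp add: inverse_eq_divide)
    then have "inverse x = a / d + (- b / d) * r"
      by (simp add: diff_divide_distrib)
    moreover have "a * a - b * b * c \<in> F" if "c \<in> F" for c
      by (intro subfield_diff subfield_mult that x)
    then have "d \<in> F" unfolding d_def using assms(1) by blast
    ultimately show ?thesis using x subfield_divide subfield_uminus by blast
  qed
next
  fix x y assume "x \<in> ?E" "y \<in> ?E"
  then obtain a b c d where xy: "x = a + b * r" "a \<in> F" "b \<in> F" "y = c + d * r" "c \<in> F" "d \<in> F"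
    by blast
  have "x + y = (a + c) + (b + d) * r" by (simp add: xy algebra_simps)
  then show "x + y \<in> ?E" using xy subfield_add by blast
  have "x * y = (a * c + b * d * (r * r)) + (a * d + b * c) * r" by (simp add: xy algebra_simps)
  moreover have "a * c + b * d * e \<in> F" if "e \<in> F" for e
    by (intro subfield_add subfield_mult that xy)
  then have "a * c + b * d * (r * r) \<in> F" using assms(1) by blast
  moreover have "a * d + b * c \<in> F" by (intro subfield_add subfield_mult xy)
  ultimately show "x * y \<in> ?E" by blast
qed

end

section \<open>Extensions of dimension one and two\<close>

lemma CC_line_extension: "CC.line_extension F a E = {k * a + v | k v. k \<in> F \<and> v \<in> E}"
  by (simp add: set_eq_iff CC.line_extension_mem_iff CC_simps) blast

lemma dimension_1:
  assumes "subfield F CC"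
  shows "CC.dimension 1 F F"
proof -
  have "CC.line_extension F 1 {0} = F" by (auto simp: CC_line_extension)
  then show ?thesis
    using CC.Suc_dim[of 1 "{0}" 0 F] CC.zero_dim[of F] by (simp add: CC_simps)
qed

lemma dimension_2_adjoin:
  assumes "subfield F CC" "r \<notin> F"
  shows "CC.dimension 2 F {a + b * r | a b. a \<in> F \<and> b \<in> F}"
proof -
  have "CC.line_extension F r F = {a + b * r | a b. a \<in> F \<and> b \<in> F}"
    by (auto simp: CC_line_extension) (metis add.commute)+
  then show ?thesis
    using CC.Suc_dim[of r F 1 F] dimension_1[OF assms(1)] assms(2)
    by (simp add: CC_simps numeral_2_eq_2)
qed

lemma dimension_2E:
  assumes "CC.dimension 2 F E"
  obtains v w where "E = {k * v + l * w | k l. k \<in> F \<and> l \<in> F}"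
proof -
  from assms have "CC.dimension (Suc (Suc 0)) F E" by (simp add: numeral_2_eq_2)
  then obtain v E' where 1: "E = CC.line_extension F v E'" "CC.dimension (Suc 0) F E'"
    by (cases rule: CC.dimension.cases) auto
  from 1(2) obtain w E'' where 2: "E' = CC.line_extension F w E''" "CC.dimension 0 F E''"
    by (cases rule: CC.dimension.cases) auto
  from 2(2) have 3: "E'' = {0}" by (cases rule: CC.dimension.cases) (auto simp: CC_simps)
  show ?thesis
    by (rule that[of v w]) (auto simp: 1(1) 2(1) 3 CC_line_extension)
qed

section \<open>Totally real and totally imaginary fields\<close>

lemma conjugate_over_Q_refl: "algebraic x \<Longrightarrow> conjugate_over_Q x x"
  unfolding conjugate_over_Q_def using algebraic_irreducible by metis

text \<open>The conjugates of an algebraic number are exactly its images under embeddings.\<close>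

lemma totally_real_iff_embedding:
  "totally_real F \<longleftrightarrow> algebraic_field F \<and> (\<forall>\<sigma>. embedding \<sigma> \<longrightarrow> (\<forall>x\<in>F. \<sigma> x \<in> \<real>))"
  unfolding totally_real_def algebraic_field_def
  using embedding_conjugate conjugate_embedding by metis

lemma totally_real_imp_Reals:
  assumes "totally_real F" "x \<in> F"
  shows "x \<in> \<real>"
  using assms conjugate_over_Q_refl unfolding totally_real_def algebraic_field_def by blast

lemma algebraic_field_algebraic_numbers: "algebraic_field {x. algebraic x}"
  unfolding algebraic_field_def subfield_CC_iff
  by (auto intro: algebraic_add algebraic_mult rat_imp_algebraic)

lemma algebraic_field_generate_field:
  assumes "\<And>x. x \<in> H \<Longrightarrow> algebraic x"
  shows "algebraic_field (generate_field CC H)"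
proof -
  have "generate_field CC H \<subseteq> {x. algebraic x}"
    using field.generate_field_min_subfield1[OF field_CC _ _, of H "{x. algebraic x}"]
      algebraic_field_algebraic_numbers assms
    by (auto simp: CC_simps algebraic_field_def)
  moreover have "subfield (generate_field CC H) CC"
    by (rule field.generate_field_is_subfield[OF field_CC]) (simp add: CC_simps)
  ultimately show ?thesis by (auto simp: algebraic_field_def)
qed

lemma algebraic_field_quadratic_compositum: "algebraic_field (quadratic_compositum F)"
  unfolding quadratic_compositum_def
  by (rule algebraic_field_generate_field) (auto simp: algebraic_field_def)

lemma sqrt_in_quadratic_compositum:
  assumes F: "algebraic_field F" and r: "r * r \<in> F"
  shows "r \<in> quadratic_compositum F"
proof -
  have sF: "subfield F CC" and aF: "\<And>x. x \<in> F \<Longrightarrow> algebraic x"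
    using F by (auto simp: algebraic_field_def)
  have "\<exists>E. r \<in> E \<and> algebraic_field E \<and> (\<exists>d\<le>2. extension_of_degree d F E)"
  proof (cases "r \<in> F")
    case True
    then show ?thesis
      using F sF dimension_1[OF sF] by (intro exI[of _ F]) (auto simp: extension_of_degree_def intro!: exI[of _ 1])
  next
    case False
    let ?E = "{a + b * r | a b. a \<in> F \<and> b \<in> F}"
    have E: "subfield ?E CC" by (rule subfield_adjoin_sqrt[OF sF r False])
    \<comment> \<open>Up to sign \<open>r\<close> is the principal square root of an algebraic
      number, hence algebraic.\<close>
    have "csqrt (r * r) = r \<or> csqrt (r * r) = - r"
      by (metis power2_csqrt power2_eq_iff power2_eq_square)
    then have "algebraic r"
      using algebraic_csqrt[OF aF[OF r]] by (metis algebraic_minus_iff)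
    then have "algebraic_field ?E"
      using E aF by (auto simp: algebraic_field_def intro!: algebraic_add algebraic_mult)
    moreover have "F \<subseteq> ?E" using subfield_0[OF sF] by force
    then have "extension_of_degree 2 F ?E"
      unfolding extension_of_degree_def using sF E dimension_2_adjoin[OF sF False] by blast
    moreover have "r \<in> ?E" using subfield_0[OF sF] subfield_1[OF sF] by force
    ultimately show ?thesis by (intro exI[of _ ?E]) blast
  qed
  then show ?thesis
    unfolding quadratic_compositum_def by (auto intro: generate_field.incl)
qed

text \<open>Every embedding maps the square root of a natural number to itself or to its negative.
  Adjoining it to \<open>M\<close> therefore keeps the field totally real, which contradicts
  maximality if the extension is proper.\<close>

lemma sqrt_nat_in_maximal_totally_real:
  assumes F: "algebraic_field F" and M: "maximal_totally_real_subfield M (quadratic_compositum F)"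
  shows "complex_of_real (sqrt (real m)) \<in> M"
proof (rule ccontr)
  define r where "r = complex_of_real (sqrt (real m))"
  assume "complex_of_real (sqrt (real m)) \<notin> M"
  then have rM: "r \<notin> M" by (simp add: r_def)
  have rr: "r * r = of_nat m"
    unfolding r_def by (metis of_nat_0_le_iff of_real_mult of_real_of_nat_eq real_sqrt_mult_self abs_of_nonneg)
  have tr: "totally_real M" and sub: "M \<subseteq> quadratic_compositum F"
    and max: "\<And>E. E \<subseteq> quadratic_compositum F \<Longrightarrow> totally_real E \<Longrightarrow> M \<subseteq> E \<Longrightarrow> E = M"
    using M by (auto simp: maximal_totally_real_subfield_def)
  have sM: "subfield M CC" and aM: "\<And>x. x \<in> M \<Longrightarrow> algebraic x"
    using tr by (auto simp: totally_real_def algebraic_field_def)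
  have sF: "subfield F CC" using F by (simp add: algebraic_field_def)
  have Q: "algebraic_field (quadratic_compositum F)" by (rule algebraic_field_quadratic_compositum)
  then have sQ: "subfield (quadratic_compositum F) CC" by (simp add: algebraic_field_def)
  have rQ: "r \<in> quadratic_compositum F"
    using sqrt_in_quadratic_compositum[OF F] rr subfield_of_nat[OF sF] by simp
  then have ar: "algebraic r" using Q by (auto simp: algebraic_field_def)
  let ?E = "{a + b * r | a b. a \<in> M \<and> b \<in> M}"
  have EQ: "?E \<subseteq> quadratic_compositum F"
    using sub rQ by (auto intro!: subfield_add[OF sQ] subfield_mult[OF sQ])
  have "subfield ?E CC"
    using rr subfield_of_nat[OF sM] by (intro subfield_adjoin_sqrt sM rM) simp
  with EQ Q have aE: "algebraic_field ?E" by (auto simp: algebraic_field_def)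
  have "totally_real ?E"
    unfolding totally_real_iff_embedding
  proof (intro conjI aE allI impI ballI)
    fix \<sigma> x assume \<sigma>: "embedding \<sigma>" and "x \<in> ?E"
    then obtain a b where x: "x = a + b * r" "a \<in> M" "b \<in> M" by blast
    have "\<sigma> r * \<sigma> r = r * r"
      using embedding_mult[OF \<sigma> ar ar] embedding_of_nat[OF \<sigma>] rr by simp
    then have "\<sigma> r = r \<or> \<sigma> r = - r" by (metis power2_eq_iff power2_eq_square)
    then have "\<sigma> r \<in> \<real>" by (auto simp: r_def)
    moreover have "\<sigma> a \<in> \<real>" "\<sigma> b \<in> \<real>"
      using tr \<sigma> x by (auto simp: totally_real_iff_embedding)
    moreover have "\<sigma> x = \<sigma> a + \<sigma> b * \<sigma> r"
      using x aM ar by (simp add: embedding_add[OF \<sigma>] embedding_mult[OF \<sigma>] algebraic_mult)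
    ultimately show "\<sigma> x \<in> \<real>" by simp
  qed
  moreover have "M \<subseteq> ?E" using subfield_0[OF sM] by force
  ultimately have "?E = M" using max EQ by blast
  moreover have "r \<in> ?E" using subfield_0[OF sM] subfield_1[OF sM] by force
  ultimately show False using rM by blast
qed

section \<open>Complex conjugation on a totally imaginary quadratic extension of a totally real
  field\<close>

lemma embedding_id: "embedding (\<lambda>x. x)"
  by (simp add: embedding_def)

lemma cnj_imaginary:
  assumes "z * z \<in> \<real>" "z \<notin> \<real>"
  shows "cnj z = - z"
proof -
  have "Im (z * z) = 0" "Im z \<noteq> 0" using assms by (auto simp: complex_is_Real_iff)
  then have "Re z = 0" by simp
  then show ?thesis by (simp add: complex_eq_iff)
qed

locale cm_field =
  fixes K L :: "complex set"
  assumes K: "totally_real K" and L: "totally_imaginary L" and deg: "extension_of_degree 2 K L"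
begin

lemma subfield_K: "subfield K CC" and subfield_L: "subfield L CC" and K_L: "K \<subseteq> L"
  and algebraic_L: "x \<in> L \<Longrightarrow> algebraic x"
  using K L deg by (auto simp: totally_real_def totally_imaginary_def algebraic_field_def
      extension_of_degree_def)

lemma not_real_hom: "f \<notin> Ring.ring_hom (CC\<lparr>carrier := L\<rparr>) RR"
  using L by (auto simp: totally_imaginary_def)

text \<open>Otherwise \<open>Re \<circ> \<sigma>\<close> would be a homomorphism from
  \<open>L\<close> to the real numbers.\<close>

lemma embedding_not_real:
  assumes "embedding \<sigma>"
  shows "\<exists>x\<in>L. \<sigma> x \<notin> \<real>"
proof (rule ccontr)
  assume "\<not> (\<exists>x\<in>L. \<sigma> x \<notin> \<real>)"
  then have re: "complex_of_real (Re (\<sigma> x)) = \<sigma> x" if "x \<in> L" for x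
    using that by (simp add: of_real_Re)
  have "Re \<circ> \<sigma> \<in> Ring.ring_hom (CC\<lparr>carrier := L\<rparr>) RR"
  proof (rule Ring.ring_hom_memI)
    fix x y assume "x \<in> carrier (CC\<lparr>carrier := L\<rparr>)" "y \<in> carrier (CC\<lparr>carrier := L\<rparr>)"
    then have xy: "x \<in> L" "y \<in> L" by simp_all
    note alg = algebraic_L[OF xy(1)] algebraic_L[OF xy(2)]
    have "Im (\<sigma> x) = 0" using re[OF xy(1)] by (metis Im_complex_of_real)
    then show "(Re \<circ> \<sigma>) (x \<otimes>\<^bsub>CC\<lparr>carrier := L\<rparr>\<^esub> y) = (Re \<circ> \<sigma>) x \<otimes>\<^bsub>RR\<^esub> (Re \<circ> \<sigma>) y"
      using embedding_mult[OF assms alg] by (simp add: ring_of_type_algebra_def)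
    show "(Re \<circ> \<sigma>) (x \<oplus>\<^bsub>CC\<lparr>carrier := L\<rparr>\<^esub> y) = (Re \<circ> \<sigma>) x \<oplus>\<^bsub>RR\<^esub> (Re \<circ> \<sigma>) y"
      using embedding_add[OF assms alg] by (simp add: ring_of_type_algebra_def)
  qed (simp_all add: ring_of_type_algebra_def embedding_1[OF assms])
  with not_real_hom show False by blast
qed

text \<open>The given generators are exchanged for 1 and a nonreal \<open>\<alpha>\<close>, and then
  the square is completed.\<close>

lemma imaginary_generator:
  obtains \<delta> where "\<delta> * \<delta> \<in> K" "\<delta> \<notin> \<real>" "L = {a + b * \<delta> | a b. a \<in> K \<and> b \<in> K}"
proof -
  note Kc = subfield_intros[OF subfield_K]
  have "CC.dimension 2 K L" using deg by (simp add: extension_of_degree_def)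
  then obtain v w where vw: "L = {k * v + l * w | k l. k \<in> K \<and> l \<in> K}"
    by (rule dimension_2E)
  obtain \<alpha> where \<alpha>: "\<alpha> \<in> L" "\<alpha> \<notin> \<real>" using embedding_not_real[OF embedding_id] by blast
  obtain a b where ab: "\<alpha> = a * v + b * w" "a \<in> K" "b \<in> K" using \<alpha>(1) vw by blast
  have "1 \<in> L" by (rule subfield_1[OF subfield_L])
  then obtain c d where cd: "1 = c * v + d * w" "c \<in> K" "d \<in> K" using vw by blast
  have indep: "x = 0" if "x * \<alpha> = y" "x \<in> K" "y \<in> K" for x y
  proof (rule ccontr)
    assume "x \<noteq> 0"
    with that have "\<alpha> = y / x" by (simp add: field_simps)
    with that Kc have "\<alpha> \<in> K" by simp
    with \<alpha>(2) totally_real_imp_Reals[OF K] show False by blast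
  qed
  \<comment> \<open>The determinant of the passage from \<open>v\<close> and \<open>w\<close> to
    \<open>\<alpha>\<close> and 1, for use in Cramer's rule.\<close>
  define e where "e = a * d - b * c"
  have 1: "d * \<alpha> - b = e * v" "a - c * \<alpha> = e * w"
  proof -
    have "d * \<alpha> - b * 1 = e * v" unfolding cd(1) ab(1) e_def by (simp add: algebra_simps)
    moreover have "a * 1 - c * \<alpha> = e * w" unfolding cd(1) ab(1) e_def by (simp add: algebra_simps)
    ultimately show "d * \<alpha> - b = e * v" "a - c * \<alpha> = e * w" by simp_all
  qed
  have "e \<noteq> 0"
  proof
    assume "e = 0"
    with 1 have "d * \<alpha> = b" "c * \<alpha> = a" by simp_all
    then have "d = 0" "c = 0" using indep ab cd by blast+
    with cd(1) show False by simp
  qed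
  have eK: "e \<in> K" unfolding e_def using ab cd by (intro Kc)
  have "v = (d * \<alpha> - b) / e" "w = (a - c * \<alpha>) / e"
    unfolding 1 using \<open>e \<noteq> 0\<close> by simp_all
  then have v: "v = (- b / e) + (d / e) * \<alpha>" and w: "w = a / e + (- c / e) * \<alpha>"
    by (simp_all add: diff_divide_distrib)
  have L\<alpha>: "\<exists>x y. z = x + y * \<alpha> \<and> x \<in> K \<and> y \<in> K" if "z \<in> L" for z
  proof -
    obtain k l where z: "z = k * v + l * w" "k \<in> K" "l \<in> K" using \<open>z \<in> L\<close> vw by blast
    have "z = (k * (- b / e) + l * (a / e)) + (k * (d / e) + l * (- c / e)) * \<alpha>"
      unfolding z(1) by (subst v, subst w) (simp add: algebra_simps)
    moreover have "k * (- b / e) + l * (a / e) \<in> K"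
      using z ab cd eK by (intro Kc; assumption?)
    moreover have "k * (d / e) + l * (- c / e) \<in> K"
      using z ab cd eK by (intro Kc; assumption?)
    ultimately show ?thesis by blast
  qed
  have "\<alpha> * \<alpha> \<in> L" by (rule subfield_mult[OF subfield_L \<alpha>(1) \<alpha>(1)])
  then obtain s t where st: "\<alpha> * \<alpha> = s + t * \<alpha>" "s \<in> K" "t \<in> K" using L\<alpha> by blast
  \<comment> \<open>Completing the square in the equation
    \<open>\<alpha> * \<alpha> = s + t * \<alpha>\<close>.\<close>
  define \<delta> where "\<delta> = \<alpha> - t / 2"
  have t2: "t / 2 \<in> K" using st(3) by (intro Kc)
  have "\<delta> * \<delta> = s + t / 2 * (t / 2)"
    unfolding \<delta>_def using st(1) by (simp add: algebra_simps)
  also have "\<dots> \<in> K"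
    by (intro subfield_add[OF subfield_K] subfield_mult[OF subfield_K] st(2) t2)
  finally have "\<delta> * \<delta> \<in> K" .
  moreover have "\<delta> \<notin> \<real>"
  proof
    assume "\<delta> \<in> \<real>"
    then have "\<delta> + t / 2 \<in> \<real>" using totally_real_imp_Reals[OF K t2] by (rule Reals_add)
    with \<alpha>(2) show False by (simp add: \<delta>_def)
  qed
  moreover have "L = {a + b * \<delta> | a b. a \<in> K \<and> b \<in> K}"
  proof (intro equalityI subsetI)
    fix z assume "z \<in> L"
    then obtain x y where z: "z = x + y * \<alpha>" "x \<in> K" "y \<in> K" using L\<alpha> by blast
    then have "z = (x + y * (t / 2)) + y * \<delta>" by (simp add: \<delta>_def algebra_simps)
    moreover have "x + y * (t / 2) \<in> K"
      by (intro subfield_add[OF subfield_K] subfield_mult[OF subfield_K] z t2)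
    ultimately show "z \<in> {a + b * \<delta> | a b. a \<in> K \<and> b \<in> K}" using z(3) by blast
  next
    have "\<delta> \<in> L" unfolding \<delta>_def using \<alpha>(1) t2 K_L by (intro subfield_diff[OF subfield_L]) auto
    moreover fix z assume "z \<in> {a + b * \<delta> | a b. a \<in> K \<and> b \<in> K}"
    ultimately show "z \<in> L"
      using K_L by (auto intro!: subfield_add[OF subfield_L] subfield_mult[OF subfield_L])
  qed
  ultimately show ?thesis by (rule that)
qed

lemma embedding_real: "embedding \<sigma> \<Longrightarrow> x \<in> K \<Longrightarrow> \<sigma> x \<in> \<real>"
  using K by (auto simp: totally_real_iff_embedding)

text \<open>Both \<open>\<delta>\<close> and \<open>\<sigma> \<delta>\<close> are nonreal numbers
  with real squares, so conjugation negates them, while it fixes \<open>K\<close> and the image of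
  \<open>K\<close> under \<open>\<sigma>\<close>.\<close>

lemma embedding_cnj:
  assumes \<sigma>: "embedding \<sigma>" and "z \<in> L"
  shows "\<sigma> (cnj z) = cnj (\<sigma> z)"
proof -
  obtain \<delta> where \<delta>: "\<delta> * \<delta> \<in> K" "\<delta> \<notin> \<real>" "L = {a + b * \<delta> | a b. a \<in> K \<and> b \<in> K}"
    by (rule imaginary_generator)
  have real: "cnj a = a" if "a \<in> K" for a
    using totally_real_imp_Reals[OF K that] by (simp add: Reals_cnj_iff)
  have cnj: "cnj (a + b * \<delta>) = a + (- b) * \<delta>" if "a \<in> K" "b \<in> K" for a b
    using that cnj_imaginary[OF totally_real_imp_Reals[OF K \<delta>(1)] \<delta>(2)] by (simp add: real)
  obtain a b where z: "z = a + b * \<delta>" "a \<in> K" "b \<in> K" using \<open>z \<in> L\<close> \<delta>(3) by blast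
  have "\<delta> \<in> L" unfolding \<delta>(3) using subfield_0[OF subfield_K] subfield_1[OF subfield_K] by force
  then have alg: "algebraic \<delta>" by (rule algebraic_L)
  have algK: "algebraic k" if "k \<in> K" for k using K_L algebraic_L that by blast
  have lin: "\<sigma> (k + l * \<delta>) = \<sigma> k + \<sigma> l * \<sigma> \<delta>" if "k \<in> K" "l \<in> K" for k l
    using that alg algK by (simp add: embedding_add[OF \<sigma>] embedding_mult[OF \<sigma>] algebraic_mult)
  have "\<sigma> \<delta> \<notin> \<real>"
  proof
    assume "\<sigma> \<delta> \<in> \<real>"
    then have "\<sigma> x \<in> \<real>" if "x \<in> L" for x
      using that lin embedding_real[OF \<sigma>] unfolding \<delta>(3) by auto
    with embedding_not_real[OF \<sigma>] show False by blast
  qed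
  moreover have "\<sigma> \<delta> * \<sigma> \<delta> \<in> \<real>"
    using embedding_real[OF \<sigma> \<delta>(1)] embedding_mult[OF \<sigma> alg alg] by simp
  ultimately have "cnj (\<sigma> \<delta>) = - \<sigma> \<delta>" by (intro cnj_imaginary)
  moreover have "cnj (\<sigma> k) = \<sigma> k" if "k \<in> K" for k
    using embedding_real[OF \<sigma> that] by (simp add: Reals_cnj_iff)
  ultimately have "cnj (\<sigma> z) = \<sigma> a + \<sigma> (- b) * \<sigma> \<delta>"
    using z lin algK by (simp add: embedding_uminus[OF \<sigma>])
  also have "\<dots> = \<sigma> (cnj z)"
    unfolding z(1) cnj[OF z(2,3)] using z subfield_uminus[OF subfield_K] by (simp only: lin)
  finally show ?thesis by simp
qed

section \<open>Units congruent to 1 modulo 3 and the bounds they provide\<close>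

abbreviation \<O> :: "complex set"
  where "\<O> \<equiv> {x \<in> L. algebraic_int x}"

lemma O_add: "x \<in> \<O> \<Longrightarrow> y \<in> \<O> \<Longrightarrow> x + y \<in> \<O>"
  and O_mult: "x \<in> \<O> \<Longrightarrow> y \<in> \<O> \<Longrightarrow> x * y \<in> \<O>"
  and O_uminus: "x \<in> \<O> \<Longrightarrow> - x \<in> \<O>"
  and O_of_nat: "of_nat n \<in> \<O>"
  using subfield_intros[OF subfield_L] by (auto intro: algebraic_int_add algebraic_int_mult)

lemma O_diff: "x \<in> \<O> \<Longrightarrow> y \<in> \<O> \<Longrightarrow> x - y \<in> \<O>"
  using O_add[of x "- y"] O_uminus by simp

lemma O_0: "0 \<in> \<O>" and O_1: "1 \<in> \<O>" and O_numeral: "numeral k \<in> \<O>"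
  using O_of_nat[of 0] O_of_nat[of 1] O_of_nat[of "numeral k"] by simp_all

lemma O_prod: "(\<And>i. i \<in> I \<Longrightarrow> f i \<in> \<O>) \<Longrightarrow> (\<Prod>i\<in>I. f i) \<in> \<O>"
  by (induction I rule: infinite_finite_induct) (use O_1 O_mult in auto)

lemma O_power: "x \<in> \<O> \<Longrightarrow> x ^ n \<in> \<O>"
  by (induction n) (use O_1 O_mult in auto)

lemma O_algebraic: "x \<in> \<O> \<Longrightarrow> algebraic x"
  by auto

text \<open>The quotient of such a unit \<open>u\<close> by its complex conjugate is congruent to \<open>1\<close> modulo \<open>3\<close> and has
  absolute value \<open>1\<close> under all embeddings.\<close>

lemma unit_real:
  assumes "u \<in> \<O>" "u' \<in> \<O>" "t \<in> \<O>" "u * u' = 1" "u = 1 + 3 * t"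
  shows "cnj u = u"
proof -
  have alg: "algebraic u" "algebraic u'" "algebraic t" "algebraic (cnj t)" "algebraic (cnj u')"
    using assms(1-3) by auto
  \<comment> \<open>This is \<open>(u / cnj u - 1) / 3\<close> with \<open>cnj u'\<close> for the
    inverse of \<open>cnj u\<close>, a form that exhibits an algebraic integer.\<close>
  define g where "g = (t - cnj t) * cnj u'"
  have cu: "cnj u = 1 + 3 * cnj t" using assms(5) by simp
  have cuu: "cnj u * cnj u' = 1" using assms(4) by (metis complex_cnj_mult complex_cnj_one)
  have g3: "g + g + g = u * cnj u' - 1"
  proof -
    have "g + g + g = (u - cnj u) * cnj u'" unfolding g_def cu assms(5) by (simp add: algebra_simps)
    then show ?thesis using cuu by (simp add: algebra_simps)
  qed
  have "algebraic_int g"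
    unfolding g_def using assms(2,3)
    by (intro algebraic_int_mult) (auto intro: algebraic_int_add[of t "- cnj t", simplified])
  moreover have "cmod (\<sigma> g) < 1" if \<sigma>: "embedding \<sigma>" for \<sigma>
  proof -
    have ag: "algebraic g" using \<open>algebraic_int g\<close> by auto
    have "3 * \<sigma> g = \<sigma> g + \<sigma> g + \<sigma> g" by simp
    also have "\<dots> = \<sigma> (g + g + g)"
      by (simp only: embedding_add[OF \<sigma> ag ag] embedding_add[OF \<sigma> algebraic_add[OF ag ag] ag])
    also have "\<dots> = \<sigma> u * cnj (\<sigma> u') - 1"
    proof -
      have 1: "algebraic (1 :: complex)" by (rule rat_imp_algebraic) simp
      have "\<sigma> (cnj u') = cnj (\<sigma> u')" using assms(2) by (intro embedding_cnj[OF \<sigma>]) simp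
      then show ?thesis
        unfolding g3 embedding_diff[OF \<sigma> algebraic_mult[OF alg(1,5)] 1]
          embedding_mult[OF \<sigma> alg(1,5)] embedding_1[OF \<sigma>] by simp
    qed
    finally have "3 * cmod (\<sigma> g) = cmod (\<sigma> u * cnj (\<sigma> u') - 1)"
      by (metis norm_mult norm_numeral)
    also have "\<dots> \<le> cmod (\<sigma> u * cnj (\<sigma> u')) + 1"
      by (metis norm_one norm_triangle_ineq4)
    \<comment> \<open>Conjugating one factor does not change the absolute value, and
      \<open>u * u' = 1\<close>.\<close>
    also have "cmod (\<sigma> u * cnj (\<sigma> u')) = cmod (\<sigma> (u * u'))"
      using alg by (simp add: embedding_mult[OF \<sigma>] norm_mult)
    also have "\<dots> = 1" using assms(4) by (simp add: embedding_1[OF \<sigma>])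
    finally show ?thesis by simp
  qed
  ultimately have "g = 0" by (rule algebraic_int_small_eq_0)
  moreover have "cnj u' \<noteq> 0" using cuu by auto
  ultimately have "t = cnj t" by (simp add: g_def)
  with cu assms(5) show ?thesis by simp
qed

lemma unit_trace_ge_2:
  assumes "u \<in> \<O>" "u' \<in> \<O>" "t \<in> \<O>" "u * u' = 1" "u = 1 + 3 * t" "embedding \<sigma>"
  shows "\<sigma> (u + u') \<in> \<real>" "2 \<le> cmod (\<sigma> (u + u'))"
proof -
  have alg: "algebraic u" "algebraic u'" using assms(1,2) by auto
  have "cnj (\<sigma> u) = \<sigma> u"
    using embedding_cnj[OF assms(6), of u] unit_real[OF assms(1-5)] assms(1) by simp
  then obtain a where a: "\<sigma> u = complex_of_real a" by (metis Reals_cases Reals_cnj_iff)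
  have "\<sigma> u * \<sigma> u' = 1"
    using embedding_mult[OF assms(6) alg] embedding_1[OF assms(6)] assms(4) by simp
  then have a0: "a \<noteq> 0" and u': "\<sigma> u' = complex_of_real (inverse a)"
    using a by (auto simp: inverse_unique)
  have s: "\<sigma> (u + u') = complex_of_real (a + inverse a)"
    using embedding_add[OF assms(6) alg] a u' by simp
  then show "\<sigma> (u + u') \<in> \<real>" by simp
  have "2 \<le> \<bar>a + inverse a\<bar>"
  proof (rule power2_le_imp_le)
    have "(a + inverse a)\<^sup>2 = 2\<^sup>2 + (a - inverse a)\<^sup>2" 
      using right_inverse[OF a0] by (simp add: power2_sum power2_diff mult.assoc)
    then show "2\<^sup>2 \<le> \<bar>a + inverse a\<bar>\<^sup>2" by simp
  qed simp
  then show "2 \<le> cmod (\<sigma> (u + u'))" unfolding s norm_of_real .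
qed

text \<open>The inverse is an argument of its own, so that \<open>u + u'\<close> is a ring term and
  the condition is first-order.\<close>

definition unit_pair :: "complex \<Rightarrow> complex \<Rightarrow> bool"
  where "unit_pair u u' \<longleftrightarrow> u * u' = 1 \<and> (\<exists>t\<in>\<O>. u = 1 + 3 * t)"

lemma unit_pair_trace:
  assumes "u \<in> \<O>" "u' \<in> \<O>" "unit_pair u u'" "embedding \<sigma>"
  shows "\<sigma> (u + u') \<in> \<real>" "2 \<le> cmod (\<sigma> (u + u'))"
  using assms unit_trace_ge_2 unfolding unit_pair_def by blast+

text \<open>The condition \<open>(1 + 9 * w) * (u + u') = s\<close> bounds \<open>w\<close>, since \<open>u + u'\<close> has absolute value at
  least \<open>2\<close> under all embeddings.\<close>

definition bounded_divisor :: "complex \<Rightarrow> complex \<Rightarrow> complex \<Rightarrow> complex \<Rightarrow> complex \<Rightarrow> bool"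
  where "bounded_divisor s c d f w \<longleftrightarrow>
    (\<exists>u\<in>\<O>. \<exists>u'\<in>\<O>. unit_pair u u' \<and> (1 + 9 * w) * (u + u') = s) \<and>
    (\<exists>g\<in>\<O>. (1 + d * (w + c)) * g = f)"

text \<open>Quantification over sets that allow descent to 0 is replaced by quantification over the
  parameters \<open>s\<close>, \<open>c\<close>, \<open>d\<close>, \<open>f\<close> of a definable
  family of sets.\<close>

definition definable_nat :: "complex \<Rightarrow> bool"
  where "definable_nat v \<longleftrightarrow> (\<exists>s\<in>\<O>. \<exists>c\<in>\<O>. \<exists>d\<in>\<O>. \<exists>f\<in>\<O>.
    (\<exists>u\<in>\<O>. \<exists>u'\<in>\<O>. unit_pair u u' \<and> s = u + u') \<and>
    bounded_divisor s c d f v \<and>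
    (\<forall>w\<in>\<O>. bounded_divisor s c d f w \<longrightarrow>
      w = 0 \<or> (\<exists>x\<in>\<O>. w = x + 1 \<and> bounded_divisor s c d f x)))"

lemma bounded_divisor_bound:
  assumes "bounded_divisor s c d f w" "w \<in> \<O>" "embedding \<sigma>" "s \<in> \<O>"
  shows "2 * cmod (1 + 9 * \<sigma> w) \<le> cmod (\<sigma> s)"
    and "\<sigma> s \<in> \<real> \<Longrightarrow> \<sigma> w \<in> \<real>"
proof -
  obtain u u' where u: "u \<in> \<O>" "u' \<in> \<O>" "unit_pair u u'" "(1 + 9 * w) * (u + u') = s"
    using assms(1) unfolding bounded_divisor_def by blast
  note tr = unit_pair_trace[OF u(1-3) assms(3)]
  have w: "algebraic w" using assms(2) by blast
  have c: "algebraic (of_nat n :: complex)" for n by (rule rat_imp_algebraic) simp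
  have "\<sigma> (of_nat 1 + of_nat 9 * w) = of_nat 1 + of_nat 9 * \<sigma> w"
    by (simp only: embedding_add[OF assms(3) c algebraic_mult[OF c w]] embedding_mult[OF assms(3) c w]
        embedding_of_nat[OF assms(3)])
  then have lin: "\<sigma> (1 + 9 * w) = 1 + 9 * \<sigma> w" by simp
  have "1 + 9 * w \<in> \<O>" by (intro O_add O_mult O_1 O_numeral assms(2))
  then have "\<sigma> s = (1 + 9 * \<sigma> w) * \<sigma> (u + u')"
    unfolding u(4)[symmetric] lin[symmetric] using O_add[OF u(1,2)]
    by (intro embedding_mult[OF assms(3)] O_algebraic)
  note s = this
  have "2 * cmod (1 + 9 * \<sigma> w) \<le> cmod (\<sigma> (u + u')) * cmod (1 + 9 * \<sigma> w)"
    by (rule mult_right_mono[OF tr(2)]) simp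
  also have "\<dots> = cmod (\<sigma> s)" unfolding s norm_mult by (rule mult.commute)
  finally show "2 * cmod (1 + 9 * \<sigma> w) \<le> cmod (\<sigma> s)" .
  show "\<sigma> w \<in> \<real>" if "\<sigma> s \<in> \<real>"
  proof -
    have "\<sigma> (u + u') \<noteq> 0" using tr(2) by auto
    \<comment> \<open>The relation is linear in \<open>\<sigma> w\<close>, and solving it involves
      real numbers only.\<close>
    then have "\<sigma> w = (\<sigma> s / \<sigma> (u + u') - 1) / 9" unfolding s by simp
    also have "\<dots> \<in> \<real>" using that tr(1) by simp
    finally show ?thesis .
  qed
qed

text \<open>If the descent from \<open>v\<close> never met 0, all \<open>v - of_nat j\<close> would
  obey a common bound, already under the identity embedding.\<close>

lemma definable_nat_imp_Nats:
  assumes "definable_nat v" "v \<in> \<O>"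
  shows "v \<in> \<nat>"
proof (rule ccontr)
  assume v: "v \<notin> \<nat>"
  obtain s c d f where s: "s \<in> \<O>" and b: "bounded_divisor s c d f v"
    and step: "\<And>w. w \<in> \<O> \<Longrightarrow> bounded_divisor s c d f w \<Longrightarrow>
      w = 0 \<or> (\<exists>x\<in>\<O>. w = x + 1 \<and> bounded_divisor s c d f x)"
    using assms(1) unfolding definable_nat_def by blast
  have desc: "v - of_nat j \<in> \<O> \<and> bounded_divisor s c d f (v - of_nat j)" for j
  proof (induction j)
    case (Suc j)
    have "v - of_nat j \<noteq> 0" using v by auto
    with step Suc obtain x where "x \<in> \<O>" "v - of_nat j = x + 1" "bounded_divisor s c d f x" by blast
    moreover from this(2) have "x = v - of_nat (Suc j)" by (simp add: algebra_simps)
    ultimately show ?case by simp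
  qed (use b assms(2) in simp)
  \<comment> \<open>The triangle inequality for \<open>1 + 9 * v\<close> and
    \<open>1 + 9 * (v - of_nat j)\<close> yields this bound for \<open>9 * j\<close>.\<close>
  define B where "B = cmod s / 2 + cmod (1 + 9 * v)"
  have "9 * real j \<le> B" for j
  proof -
    have "2 * cmod (1 + 9 * (v - of_nat j)) \<le> cmod s"
      using bounded_divisor_bound(1)[OF _ _ embedding_id s] desc[of j] by blast
    moreover have "cmod (9 * of_nat j) \<le> cmod (1 + 9 * v) + cmod (1 + 9 * (v - of_nat j))"
      using norm_triangle_ineq4[of "1 + 9 * v" "1 + 9 * (v - of_nat j)"] by (simp add: algebra_simps)
    moreover have "cmod (9 * of_nat j) = 9 * real j" by (simp add: norm_mult)
    ultimately show ?thesis by (simp add: B_def)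
  qed
  moreover obtain j where "B < real j" using reals_Archimedean2 by blast
  ultimately have "9 * real j < real j" by (meson le_less_trans)
  then show False by simp
qed

end

section \<open>Every natural number satisfies the defining condition\<close>

lemma algebraic_int_quadratic:
  fixes t :: complex
  assumes "t * t - of_int b * t - of_int c = 0"
  shows "algebraic_int t"
proof (rule algebraic_int.intros)
  show "lead_coeff [:- of_int c, - of_int b, 1 :: complex:] = 1" by simp
  show "\<forall>i. coeff [:- of_int c, - of_int b, 1 :: complex:] i \<in> \<int>"
    by (auto simp: coeff_pCons split: nat.splits)
  show "poly [:- of_int c, - of_int b, 1:] t = 0" using assms by (simp add: algebra_simps)
qed

lemma prod_mod_9:
  obtains z :: nat where "(\<Prod>k\<in>I. 1 + 9 * f k) = 1 + 9 * z"
proof -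
  have "\<exists>z::nat. (\<Prod>k\<in>I. 1 + 9 * f k) = 1 + 9 * z"
  proof (induction I rule: infinite_finite_induct)
    case (insert i I)
    then obtain z where "(\<Prod>k\<in>I. 1 + 9 * f k) = 1 + 9 * z" by blast
    with insert.hyps show ?case by (intro exI[of _ "z + f i + 9 * f i * z"]) (simp add: algebra_simps)
  qed auto
  with that show ?thesis by blast
qed

locale cm_field_sqrt = cm_field +
  assumes sqrt_nat: "complex_of_real (sqrt (real m)) \<in> L"
begin

text \<open>The units are the roots of \<open>X^2 - (2 + 9 * z) * X + 1\<close>, whose discriminant
  is \<open>9 * m\<close>. They are congruent to 1 modulo 3 because \<open>t\<close> is a root of
  \<open>X^2 - 3 * z * X - z\<close>.\<close>

lemma unit_pair_exists:
  obtains u u' where "u \<in> \<O>" "u' \<in> \<O>" "unit_pair u u'" "u + u' = of_nat (2 + 9 * z)"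
proof -
  define m where "m = 9 * z * z + 4 * z"
  define r where "r = complex_of_real (sqrt (real m))"
  have rr: "r * r = of_nat m"
    unfolding r_def by (metis of_nat_0_le_iff of_real_mult of_real_of_nat_eq real_sqrt_mult_self abs_of_nonneg)
  define t where "t = (3 * of_nat z + r) / 2"
  define u where "u = 1 + 3 * t"
  define u' where "u' = of_nat (2 + 9 * z) - u"
  have "r \<in> L" unfolding r_def by (rule sqrt_nat)
  then have "t \<in> L" unfolding t_def
    by (intro subfield_divide[OF subfield_L] subfield_add[OF subfield_L] subfield_mult[OF subfield_L]
      subfield_numeral[OF subfield_L] subfield_of_nat[OF subfield_L])
  have t2: "2 * t = 3 * of_nat z + r" by (simp add: t_def)
  have "4 * (t * t) = (2 * t) * (2 * t)" by simp
  also have "\<dots> = 9 * of_nat z * of_nat z + 6 * of_nat z * r + r * r"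
    unfolding t2 by (simp add: algebra_simps)
  also have "\<dots> = 6 * of_nat z * (3 * of_nat z + r) + 4 * of_nat z"
    unfolding rr m_def by (simp add: algebra_simps)
  also have "\<dots> = 4 * (3 * of_nat z * t + of_nat z)"
    unfolding t2[symmetric] by (simp add: algebra_simps)
  finally have "4 * (t * t) = 4 * (3 * of_nat z * t + of_nat z)" .
  then have tt: "t * t = 3 * of_nat z * t + of_nat z" by (simp only: mult_cancel_left) simp
  then have "algebraic_int t"
    by (intro algebraic_int_quadratic[of t "3 * int z" "int z"]) simp
  with \<open>t \<in> L\<close> have t: "t \<in> \<O>" by simp
  have u: "u \<in> \<O>" unfolding u_def by (intro O_add O_mult O_1 O_numeral t)
  then have u': "u' \<in> \<O>" unfolding u'_def by (intro O_diff O_of_nat)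
  have "u * u' = 1 + 9 * of_nat z + 27 * of_nat z * t - 9 * (t * t)"
    unfolding u'_def u_def by (simp add: algebra_simps)
  also have "\<dots> = 1" unfolding tt by (simp add: algebra_simps)
  finally have "unit_pair u u'" unfolding unit_pair_def using t u_def by blast
  with u u' show ?thesis by (intro that[of u u']) (simp_all add: u'_def)
qed

text \<open>Modulo \<open>1 + d * e\<close> the factor \<open>d\<close> is invertible and \<open>1 + d * (b k + e)\<close> is congruent to
  \<open>d * b k\<close>.\<close>

lemma dvd_prod_shift:
  assumes "d \<in> \<O>" "e \<in> \<O>" "g \<in> \<O>" "\<And>k. b k \<in> \<O>" and g: "(1 + d * e) * g = (\<Prod>k<(m::nat). 1 + d * (b k + e))"
  shows "\<exists>h\<in>\<O>. (1 + d * e) * h = (\<Prod>k<m. b k)"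
proof -
  note O = O_add O_mult O_uminus O_diff O_1 O_power assms(1-4)
  define \<mu> where "\<mu> = 1 + d * e"
  have \<mu>: "\<mu> \<in> \<O>" unfolding \<mu>_def by (intro O)
  \<comment> \<open>Each factor equals \<open>\<mu> + d * b k\<close>, so on expansion everything
    but the product of the \<open>d * b k\<close> is a multiple of \<open>\<mu>\<close>.\<close>
  have "\<exists>a\<in>\<O>. (\<Prod>k<m. 1 + d * (b k + e)) = d ^ m * (\<Prod>k<m. b k) + \<mu> * a" for m :: nat
  proof (induction m)
    case (Suc m)
    then obtain a where a: "a \<in> \<O>"
      "(\<Prod>k<m. 1 + d * (b k + e)) = d ^ m * (\<Prod>k<m. b k) + \<mu> * a" by blast
    have P: "(\<Prod>k<m. b k) \<in> \<O>" by (intro O_prod assms(4))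
    have "(\<Prod>k<Suc m. 1 + d * (b k + e)) = (d ^ m * (\<Prod>k<m. b k) + \<mu> * a) * (\<mu> + d * b m)"
    proof -
      have "1 + d * (b m + e) = \<mu> + d * b m" by (simp add: \<mu>_def algebra_simps)
      then show ?thesis by (simp only: prod.lessThan_Suc a(2))
    qed
    also have "\<dots> = d ^ Suc m * (\<Prod>k<Suc m. b k) +
        \<mu> * (d ^ m * (\<Prod>k<m. b k) + a * \<mu> + a * (d * b m))"
      by (simp add: algebra_simps)
    finally show ?case
      by (rule bexI) (intro O a \<mu> P)
  next
    case 0
    then show ?case using O_0 by (intro bexI[of _ 0]) simp_all
  qed
  then obtain a where a: "a \<in> \<O>"
    "(\<Prod>k<m. 1 + d * (b k + e)) = d ^ m * (\<Prod>k<m. b k) + \<mu> * a" by blast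
  \<comment> \<open>From \<open>1 = \<mu> + d * (- e)\<close>, the inverse of \<open>d\<close>
    modulo \<open>\<mu>\<close> is \<open>- e\<close>, and likewise for powers.\<close>
  have "\<exists>x\<in>\<O>. 1 = d ^ m * (- e) ^ m + \<mu> * x" for m :: nat
  proof (induction m)
    case (Suc m)
    then obtain x where x: "x \<in> \<O>" "1 = d ^ m * (- e) ^ m + \<mu> * x" by blast
    have "1 = (d ^ m * (- e) ^ m + \<mu> * x) * (\<mu> + d * (- e))"
      unfolding x(2)[symmetric] by (simp add: \<mu>_def)
    also have "\<dots> = d ^ Suc m * (- e) ^ Suc m + \<mu> * (d ^ m * (- e) ^ m + x * \<mu> + x * (d * (- e)))"
      by (simp add: algebra_simps)
    finally show ?case
      by (rule bexI) (intro O x \<mu>)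
  next
    case 0
    then show ?case using O_0 by (intro bexI[of _ 0]) simp_all
  qed
  then obtain x where x: "x \<in> \<O>" "1 = d ^ m * (- e) ^ m + \<mu> * x" by blast
  define P where "P = (\<Prod>k<m. b k)"
  have P: "P \<in> \<O>" unfolding P_def by (intro O_prod assms(4))
  have dP: "d ^ m * P = \<mu> * (g - a)"
    using a(2) g by (simp add: P_def \<mu>_def algebra_simps)
  \<comment> \<open>Multiplication by \<open>(- e) ^ m\<close> cancels \<open>d ^ m\<close> modulo
    \<open>\<mu>\<close>.\<close>
  have "P = (d ^ m * P) * (- e) ^ m + \<mu> * (x * P)"
  proof -
    have "P = (d ^ m * (- e) ^ m + \<mu> * x) * P" unfolding x(2)[symmetric] by simp
    then show ?thesis by (simp only: ring_distribs mult_ac)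
  qed
  also have "\<dots> = \<mu> * ((g - a) * (- e) ^ m + x * P)"
    unfolding dP by (simp add: algebra_simps)
  finally have "\<mu> * ((g - a) * (- e) ^ m + x * P) = P" by simp
  moreover have "(g - a) * (- e) ^ m + x * P \<in> \<O>" by (intro O a x P)
  ultimately show ?thesis unfolding \<mu>_def P_def by blast
qed

text \<open>The parameters are chosen such that the set they describe consists of 0 to
  \<open>n\<close> exactly.\<close>

lemma definable_nat_of_nat: "definable_nat (of_nat n)"
proof -
  \<comment> \<open>Every \<open>1 + 9 * k\<close> divides \<open>M\<close>, and the cofactor is
    twice a number congruent to 1 modulo 9, hence the trace of a unit pair.\<close>
  define M where "M = 2 * (\<Prod>k\<le>n. 1 + 9 * k)"
  \<comment> \<open>The conjugates of the \<open>w\<close> in the set are real and at most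
    \<open>M\<close> in absolute value, so adding \<open>c\<close> makes them at least 1.\<close>
  define c where "c = M + 1"
  \<comment> \<open>This bounds the product of the \<open>\<bar>k - x\<bar>\<close> over
    \<open>k \<le> n\<close> for all real \<open>x\<close> of absolute value at most
    \<open>M\<close>.\<close>
  define d where "d = (n + M) ^ Suc n"
  define f where "f = (\<Prod>k<Suc n. 1 + d * (k + c))"
  let ?X = "bounded_divisor (of_nat M) (of_nat c) (of_nat d) (of_nat f)"
  obtain u u' where u: "u \<in> \<O>" "u' \<in> \<O>" "unit_pair u u'" "u + u' = of_nat M"
  proof -
    obtain z where "(\<Prod>k\<le>n. 1 + 9 * k) = 1 + 9 * z" by (rule prod_mod_9)
    then have M: "M = 2 + 9 * (2 * z)" by (simp add: M_def)
    obtain v v' where "v \<in> \<O>" "v' \<in> \<O>" "unit_pair v v'" "v + v' = of_nat (2 + 9 * (2 * z))"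
      by (rule unit_pair_exists)
    then show ?thesis unfolding M[symmetric] by (rule that)
  qed
  have X: "?X (of_nat k)" if "k \<le> n" for k
  proof -
    obtain z where z: "(\<Prod>i\<in>{..n} - {k}. 1 + 9 * i) = 1 + 9 * z" by (rule prod_mod_9)
    have "M = 2 * ((1 + 9 * k) * (\<Prod>i\<in>{..n} - {k}. 1 + 9 * i))"
      unfolding M_def using that by (subst prod.remove[of _ k]) auto
    then have M: "M = (1 + 9 * k) * (2 + 9 * (2 * z))" unfolding z by (simp add: algebra_simps)
    obtain v v' where v: "v \<in> \<O>" "v' \<in> \<O>" "unit_pair v v'" "v + v' = of_nat (2 + 9 * (2 * z))"
      by (rule unit_pair_exists)
    have "(1 + 9 * of_nat k) * (v + v') = of_nat M" unfolding v(4) M by (simp add: algebra_simps)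
    moreover have "f = (1 + d * (k + c)) * (\<Prod>i\<in>{..<Suc n} - {k}. 1 + d * (i + c))"
      unfolding f_def using that by (subst prod.remove[of _ k]) auto
    then have "(1 + of_nat d * (of_nat k + of_nat c)) *
        of_nat (\<Prod>i\<in>{..<Suc n} - {k}. 1 + d * (i + c)) = (of_nat f :: complex)"
      by (simp only: of_nat_mult of_nat_add of_nat_1)
    ultimately show ?thesis
      unfolding bounded_divisor_def using v O_of_nat by blast
  qed
  have only: "\<exists>k\<le>n. w = of_nat k" if w: "w \<in> \<O>" and Xw: "?X w" for w
  proof -
    obtain g where g: "g \<in> \<O>" "(1 + of_nat d * (w + of_nat c)) * g = of_nat f"
      using Xw unfolding bounded_divisor_def by blast
    let ?b = "\<lambda>k. of_nat k - w" and ?e = "w + of_nat c"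
    have "of_nat f = (\<Prod>k<Suc n. 1 + of_nat d * (?b k + ?e))"
      unfolding f_def by (simp add: algebra_simps)
    then have "(1 + of_nat d * ?e) * g = (\<Prod>k<Suc n. 1 + of_nat d * (?b k + ?e))"
      using g(2) by simp
    then obtain h where h: "h \<in> \<O>" "(1 + of_nat d * ?e) * h = (\<Prod>k<Suc n. ?b k)"
      using dvd_prod_shift[of "of_nat d" ?e g ?b "Suc n"] g(1) O_of_nat O_add[OF w O_of_nat]
        O_diff[OF O_of_nat w] by metis
    \<comment> \<open>The quotient \<open>h\<close> then vanishes, so that one of the factors
      \<open>of_nat k - w\<close> is zero.\<close>
    have "cmod (\<sigma> h) < 1" if \<sigma>: "embedding \<sigma>" for \<sigma>
    proof -
      have M1: "1 \<le> M" unfolding M_def by (simp add: prod_ge_1 Suc_leI)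
      have sM: "\<sigma> (of_nat M) = of_nat M" by (rule embedding_of_nat[OF \<sigma>])
      have real: "\<sigma> w \<in> \<real>" and bd: "2 * cmod (1 + 9 * \<sigma> w) \<le> real M"
        using bounded_divisor_bound[OF Xw w \<sigma> O_of_nat] unfolding sM by auto
      obtain x where x: "\<sigma> w = complex_of_real x" using real by (rule Reals_cases)
      have "1 + 9 * \<sigma> w = complex_of_real (1 + 9 * x)" unfolding x by simp
      with bd have "\<bar>1 + 9 * x\<bar> \<le> real M / 2" by (simp only: norm_of_real) simp
      then have "1 + 9 * x \<le> real M / 2" "- (1 + 9 * x) \<le> real M / 2"
        unfolding abs_le_iff by simp_all
      moreover have "1 \<le> real M" using M1 by simp
      ultimately have xM: "\<bar>x\<bar> \<le> real M" by (intro abs_leI) linarith+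
      have aw: "algebraic w" and ah: "algebraic h" using w h(1) by auto
      have an: "algebraic (of_nat k :: complex)" for k by (rule rat_imp_algebraic) simp
      have ab: "algebraic (?b k)" for k using O_diff[OF O_of_nat w] by blast
      have s1: "\<sigma> (of_nat 1 + of_nat d * ?e) = complex_of_real (1 + real d * (x + real c))"
        using embedding_add[OF \<sigma> an[of 1] algebraic_mult[OF an algebraic_add[OF aw an]]]
          embedding_mult[OF \<sigma> an[of d] algebraic_add[OF aw an[of c]]] embedding_add[OF \<sigma> aw an[of c]]
        by (simp add: embedding_of_nat[OF \<sigma>] embedding_1[OF \<sigma>] x)
      have s2: "\<sigma> (?b k) = complex_of_real (real k - x)" for k
        using embedding_diff[OF \<sigma> an aw] by (simp add: embedding_of_nat[OF \<sigma>] x)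
      have "\<sigma> (of_nat 1 + of_nat d * ?e) * \<sigma> h = \<sigma> ((of_nat 1 + of_nat d * ?e) * h)"
        by (intro embedding_mult[OF \<sigma>, symmetric] algebraic_add algebraic_mult an aw ah)
      also have "\<dots> = (\<Prod>k<Suc n. \<sigma> (?b k))"
        using embedding_prod[OF \<sigma>, of "{..<Suc n}" ?b] ab h(2) by simp
      finally have "\<bar>1 + real d * (x + real c)\<bar> * cmod (\<sigma> h) = (\<Prod>k<Suc n. \<bar>real k - x\<bar>)"
        unfolding s1 s2 by (metis (no_types, lifting) norm_mult norm_of_real prod.cong prod_norm)
      also have "\<dots> \<le> (\<Prod>k<Suc n. real (n + M))"
        using xM by (intro prod_mono) auto
      also have "\<dots> = real d" by (simp add: d_def)
      finally have le: "\<bar>1 + real d * (x + real c)\<bar> * cmod (\<sigma> h) \<le> real d" .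
      have "1 \<le> x + real c" using xM by (simp add: c_def)
      then have "1 + real d \<le> \<bar>1 + real d * (x + real c)\<bar>"
        using mult_left_mono[of 1 "x + real c" "real d"] by simp
      then have *: "(1 + real d) * cmod (\<sigma> h) \<le> real d"
        using le by (meson mult_right_mono norm_ge_zero order_trans)
      show ?thesis
      proof (rule ccontr)
        assume "\<not> cmod (\<sigma> h) < 1"
        then have "(1 + real d) * 1 \<le> (1 + real d) * cmod (\<sigma> h)" by (intro mult_left_mono) auto
        then have "(1 + real d) * 1 \<le> real d" using * by (rule order_trans)
        then show False by simp
      qed
    qed
    then have "h = 0" using h(1) by (intro algebraic_int_small_eq_0) auto
    with h(2) have "(\<Prod>k<Suc n. ?b k) = 0" by simp
    then obtain k where "k < Suc n" "of_nat k - w = 0" by (auto simp: prod_zero_iff)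
    then show ?thesis by (intro exI[of _ k]) simp
  qed
  have step: "w = 0 \<or> (\<exists>x\<in>\<O>. w = x + 1 \<and> ?X x)" if w: "w \<in> \<O>" "?X w" for w
  proof -
    obtain k where k: "k \<le> n" "w = of_nat k" using only[OF w] by blast
    show ?thesis
    proof (cases k)
      case (Suc j)
      with k X[of j] O_of_nat show ?thesis by (intro disjI2 bexI[of _ "of_nat j"]) simp_all
    qed (use k in simp)
  qed
  have "\<exists>u\<in>\<O>. \<exists>u'\<in>\<O>. unit_pair u u' \<and> of_nat M = u + u'"
    using u by (intro bexI[of _ u] bexI[of _ u']) simp_all
  then show ?thesis
    unfolding definable_nat_def
    by - (rule bexI[of _ "of_nat M"], rule bexI[of _ "of_nat c"], rule bexI[of _ "of_nat d"],
        rule bexI[of _ "of_nat f"], intro conjI ballI impI step X order_refl, assumption+,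
        (rule O_of_nat)+)
qed

lemma definable_nat_iff: "v \<in> \<O> \<Longrightarrow> definable_nat v \<longleftrightarrow> v \<in> \<nat>"
  using definable_nat_imp_Nats definable_nat_of_nat by (auto elim!: Nats_cases)

section \<open>First-order definition of the natural numbers, and conclusion\<close>

interpretation ring: definability \<O> \<O> "\<lambda>x. x"
proof
  fix j
  show "\<exists>p. \<forall>e\<in>UNIV \<rightarrow> \<O>.
      satisfies (ring_of_type_algebra\<lparr>carrier := \<O>\<rparr>) e p \<longleftrightarrow> e j \<in> (\<lambda>x. x) ` \<O>"
    by (intro exI[of _ "FEq Zero Zero"]) (auto simp: Pi_iff)
qed (use O_0 O_1 O_add O_mult in auto)

lemma Rel_bounded_divisor:
  assumes "ring.Fn k s" "ring.Fn k c" "ring.Fn k d" "ring.Fn k f" "ring.Fn k w"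
  shows "ring.Rel k (\<lambda>xs. bounded_divisor (s xs) (c xs) (d xs) (f xs) (w xs))"
  unfolding bounded_divisor_def unit_pair_def
  by (intro ring.Rel_intros ring.Fn_intros assms)

lemma Rel_definable_nat: "ring.Rel 1 (\<lambda>xs. definable_nat (hd xs))"
proof -
  have "ring.Fn 1 hd" using ring.Fn_hd[of 0] by simp
  then show ?thesis
    unfolding definable_nat_def unit_pair_def
    by (intro ring.Rel_intros ring.Fn_intros Rel_bounded_divisor)
qed

theorem ring_of_integers_undecidable:
  "\<not> decidable_theory (first_order_theory (ring_of_integers L))"
proof -
  interpret nat_definability \<O> of_nat
  proof
    fix j
    obtain p where p: "\<And>e. e \<in> UNIV \<rightarrow> \<O> \<Longrightarrow> satisfies ring.R e p \<longleftrightarrow> definable_nat (e j)"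
      using ring.RelE[OF Rel_definable_nat, of "[j]"] by (auto simp: comp_def)
    show "\<exists>p. \<forall>e\<in>UNIV \<rightarrow> \<O>. satisfies ring.R e p \<longleftrightarrow> e j \<in> range of_nat"
      using p definable_nat_iff by (intro exI[of _ p]) (simp add: Pi_iff Nats_def)
  qed (use O_of_nat in \<open>auto simp: inj_on_def\<close>)
  show ?thesis using undecidable by (simp add: ring_of_integers_def)
qed

end

theorem theorem4p5:
  fixes S :: "nat set" and \<zeta> :: "nat \<Rightarrow> complex" and K0 K1 K L :: "complex set"
  assumes "infinite S" and "\<forall>n\<in>S. 0 < n"
    and "\<forall>n\<in>S. primitive_root_of_unity n (\<zeta> n)"
    and "K0 = generate_field CC {\<zeta> n + cnj (\<zeta> n) | n. n \<in> S}"
    and "maximal_totally_real_subfield K1 (quadratic_compositum K0)"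
    and "totally_real K" and "K1 \<subseteq> K"
    and "totally_imaginary L" and "extension_of_degree 2 K L"
  shows "\<not> decidable_theory (first_order_theory (ring_of_integers L))"
proof -
  have root: "algebraic (\<zeta> n)" if "n \<in> S" for n
  proof (rule algebraicI)
    have n: "0 < n" "\<zeta> n ^ n = 1"
      using assms(3) that by (auto simp: primitive_root_of_unity_def)
    show "poly (monom 1 n - 1) (\<zeta> n) = 0" using n by (simp add: poly_monom)
    have "coeff (monom 1 n - 1 :: complex poly) n = 1" using n by simp
    then show "monom 1 n - 1 \<noteq> (0 :: complex poly)" by (metis coeff_0 zero_neq_one)
    show "coeff (monom 1 n - 1 :: complex poly) i \<in> \<int>" for i by simp
  qed
  have K0: "algebraic_field K0"
    unfolding assms(4) by (rule algebraic_field_generate_field) (auto intro: algebraic_add root)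
  interpret cm_field K L
    using assms(6,8,9) by unfold_locales
  interpret cm_field_sqrt K L
  proof
    fix m
    show "complex_of_real (sqrt (real m)) \<in> L"
      \<comment> \<open>The square roots lie in \<open>K1\<close>, hence in \<open>K\<close> and in
        \<open>L\<close>.\<close>
      using sqrt_nat_in_maximal_totally_real[OF K0 assms(5)] assms(7) K_L by blast
  qed
  show ?thesis by (rule ring_of_integers_undecidable)
qed

end
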